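(* Let $n\ge2$ and let $V$ be an irreducible $J\oplus D$-module which is a weight module with respect to $\mathfrak h_0$ with finite dimensional weight spaces. Assume that there exist non-zero central operators $z_1,\dots,z_{n-1}$ on $V$ of degrees $(k_1,0,\dots,0),\dots,(0,\dots,0,k_{n-1},0)\in\mathbb Z^n$ respectively, where each $k_i$ is a positive integer. Let $W$ be a maximal $J\oplus D_{n-1}$-submodule of $V$ such that $V_1=V/W$ is an irreducible $J\oplus D_{n-1}$-module with finite dimensional weight spaces with respect to $\mathfrak h_{n-1}$. Let $\alpha\in\mathbb C^{n-1}$ and give $V_1\otimes A_{n-1}$ the $J\oplus D$-module structure $\pi(\alpha)$ (defined in the context). Then $V_1\otimes A_{n-1}$ is completely reducible as a $J\oplus D$-module.
   Context: $\mathfrak g$ is a finite dimensional simple Lie algebra over $\mathbb C$ with non-degenerate invariant symmetric bilinear form $(\cdot,\cdot)$ and Cartan subalgebra $\mathfrak h$. $\mathfrak g_{\rm aff}=\mathfrak g\otimes\mathbb C[t_n^{\pm1}]\oplus\mathbb C K_n$ with $[x\otimes t_n^a,y\otimes t_n^b]=[x,y]\otimes t_n^{a+b}+a\,\delta_{a+b,0}(x,y)K_n$ and $K_n$ central. $A_{n-1}=\mathbb C[t_1^{\pm1},\dots,t_{n-1}^{\pm1}]$, $t^{\overline m}=t_1^{m_1}\cdots t_{n-1}^{m_{n-1}}$, and $J=\mathfrak g_{\rm aff}\otimes A_{n-1}$ with bracket $[X\otimes f,Y\otimes g]=[X,Y]\otimes fg$. $D$ is the span of commuting elements $d_1,\dots,d_n$,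 and $J\oplus D$ is the semidirect product in which $d_i$ acts on $J$ as the degree derivation $t_i\frac{\partial}{\partial t_i}$ ($K_n$ having degree $0$). $D_k$ is the span of $d_{k+1},\dots,d_n$, so $D_0=D$ and $D_{n-1}=\mathbb C d_n$, and $\mathfrak h_k=\mathfrak h\oplus\mathbb C K_n\oplus D_k$. A weight module with respect to $\mathfrak h_k$ is the direct sum of its simultaneous eigenspaces (weight spaces) for $\mathfrak h_k$. Central operators: on an irreducible $J\oplus D$-module $V$ with finite dimensional weight spaces, every element $K_n\otimes t^{\overline m}$ that acts as a non-zero operator on $V$ acts invertibly. A central operator on $V$ is a scalar multiple of a finite product of operators by which such elements $K_n\otimes t^{\overline m}$ act, and inverses of such operators; it commutes with the action of $J$, and it has degree $\underline m\in\mathbb Z^n$ if $d_iz-zd_i=m_iz$ for $1\le i\le n$. Module structure $\pi(\alpha)$ on $V_1\otimes A_{n-1}$, for $\alpha=(\alpha_1,\dots,\alpha_{n-1})\in\mathbb C^{n-1}$: writing $v(\overline p)=v\otimes t^{\overline p}$ and $X(\overline m)=X\otimes t^{\overline m}$ ($X\in\mathfrak g_{\rm aff}$), $X(\overline m)\cdot v(\overline p)=(X(\overline m)v)(\overline m+\overline p)$, $d_n\cdot v(\overline p)=(d_nv)(\overline p)$, $d_i\cdot v(\overline p)=(\alpha_i+p_i)v(\overline p)$ for $1\le i\le n-1$. *)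

theory Defs
  imports "HOL-Analysis.Analysis" "HOL-Library.Poly_Mapping"
begin

section \<open>Complex vector spaces as a type class\<close>

class complex_vector = ab_group_add +
  fixes scaleC :: "complex \<Rightarrow> 'a \<Rightarrow> 'a"  (infixr \<open>*\<^sub>C\<close> 75)
  assumes scaleC_add_right: "a *\<^sub>C (x + y) = a *\<^sub>C x + a *\<^sub>C y"
    and scaleC_add_left: "(a + b) *\<^sub>C x = a *\<^sub>C x + b *\<^sub>C x"
    and scaleC_scaleC: "a *\<^sub>C b *\<^sub>C x = (a * b) *\<^sub>C x"
    and scaleC_one: "1 *\<^sub>C x = x"

global_interpretation complex_vector:
  vector_space "scaleC :: complex \<Rightarrow> 'a \<Rightarrow> 'a :: complex_vector"
  defines csubspace = complex_vector.subspace
    and cspan = complex_vector.span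
  by unfold_locales
    (simp_all add: scaleC_add_right scaleC_add_left scaleC_scaleC scaleC_one)

abbreviation clinear :: "('a::complex_vector \<Rightarrow> 'b::complex_vector) \<Rightarrow> bool" where
  "clinear \<equiv> Vector_Spaces.linear scaleC scaleC"

definition cbilinear ::
    "('a::complex_vector \<Rightarrow> 'b::complex_vector \<Rightarrow> 'c::complex_vector) \<Rightarrow> bool" where
  "cbilinear f \<longleftrightarrow> (\<forall>x. clinear (f x)) \<and> (\<forall>y. clinear (\<lambda>x. f x y))"

definition finite_dim :: "'a::complex_vector set \<Rightarrow> bool" where
  "finite_dim S \<longleftrightarrow> (\<exists>B. finite B \<and> S \<subseteq> cspan B)"

text \<open>The whole space is the internal direct sum of a set of subspaces (the zero subspace is
  allowed as a summand).\<close>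

definition direct_sum_decomposition :: "'a::complex_vector set set \<Rightarrow> bool" where
  "direct_sum_decomposition \<S> \<longleftrightarrow>
     (\<forall>S\<in>\<S>. csubspace S) \<and> cspan (\<Union>\<S>) = UNIV \<and>
     (\<forall>S\<in>\<S>. S \<inter> cspan (\<Union>(\<S> - {S})) = {0})"

instantiation complex :: complex_vector
begin
definition "a *\<^sub>C (x::complex) = a * x"
instance by standard (simp_all add: scaleC_complex_def algebra_simps)
end

instantiation prod :: (complex_vector, complex_vector) complex_vector
begin
definition "a *\<^sub>C (x :: 'a \<times> 'b) = (a *\<^sub>C fst x, a *\<^sub>C snd x)"
instance
  by standard (simp_all add: scaleC_prod_def scaleC_add_right scaleC_add_left
      scaleC_scaleC scaleC_one)
end

instantiation vec :: (complex_vector, finite) complex_vector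
begin
definition "a *\<^sub>C (x :: 'a ^ 'b) = (\<chi> i. a *\<^sub>C (x $ i))"
instance
  by standard (simp_all add: scaleC_vec_def vec_eq_iff scaleC_add_right scaleC_add_left
      scaleC_scaleC scaleC_one)
end

instantiation poly_mapping :: (type, complex_vector) complex_vector
begin
definition "a *\<^sub>C (p :: 'a \<Rightarrow>\<^sub>0 'b) = Poly_Mapping.map (scaleC a) p"

lemma lookup_scaleC [simp]:
  "poly_mapping.lookup (a *\<^sub>C p) k = a *\<^sub>C poly_mapping.lookup (p :: 'a \<Rightarrow>\<^sub>0 'b) k"
  by (simp add: scaleC_poly_mapping_def map.rep_eq when_def)

instance
  by standard (auto intro!: poly_mapping_eqI simp: lookup_add scaleC_add_right scaleC_add_left
      scaleC_scaleC scaleC_one)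
end

section \<open>Lie algebras\<close>

locale lie_algebra =
  fixes br :: "'g::complex_vector \<Rightarrow> 'g \<Rightarrow> 'g"
  assumes cbilinear_br: "cbilinear br"
    and br_self: "br x x = 0"
    and jacobi: "br x (br y z) + br y (br z x) + br z (br x y) = 0"

definition lie_ideal :: "('g::complex_vector \<Rightarrow> 'g \<Rightarrow> 'g) \<Rightarrow> 'g set \<Rightarrow> bool" where
  "lie_ideal br I \<longleftrightarrow> csubspace I \<and> (\<forall>x. \<forall>y\<in>I. br x y \<in> I)"

definition simple_lie_algebra :: "('g::complex_vector \<Rightarrow> 'g \<Rightarrow> 'g) \<Rightarrow> bool" where
  "simple_lie_algebra br \<longleftrightarrow>
     lie_algebra br \<and> (\<exists>x y. br x y \<noteq> 0) \<and> (\<forall>I. lie_ideal br I \<longrightarrow> I = {0} \<or> I = UNIV)"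

primrec lower_central :: "('g::complex_vector \<Rightarrow> 'g \<Rightarrow> 'g) \<Rightarrow> 'g set \<Rightarrow> nat \<Rightarrow> 'g set" where
  "lower_central br H 0 = H"
| "lower_central br H (Suc k) = cspan {br x y | x y. x \<in> H \<and> y \<in> lower_central br H k}"

text \<open>A Cartan subalgebra is a nilpotent self-normalizing subalgebra.\<close>

definition cartan_subalgebra :: "('g::complex_vector \<Rightarrow> 'g \<Rightarrow> 'g) \<Rightarrow> 'g set \<Rightarrow> bool" where
  "cartan_subalgebra br H \<longleftrightarrow>
     csubspace H \<and> (\<forall>x\<in>H. \<forall>y\<in>H. br x y \<in> H) \<and>
     (\<exists>k. lower_central br H k = {0}) \<and>
     (\<forall>x. (\<forall>y\<in>H. br x y \<in> H) \<longrightarrow> x \<in> H)"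

definition invariant_form ::
    "('g::complex_vector \<Rightarrow> 'g \<Rightarrow> 'g) \<Rightarrow> ('g \<Rightarrow> 'g \<Rightarrow> complex) \<Rightarrow> bool" where
  "invariant_form br form \<longleftrightarrow>
     cbilinear form \<and> (\<forall>x y. form x y = form y x) \<and>
     (\<forall>x y z. form (br x y) z = form x (br y z)) \<and>
     (\<forall>x. (\<forall>y. form x y = 0) \<longrightarrow> x = 0)"

section \<open>The Lie algebra \<open>J \<oplus> D\<close>\<close>

text \<open>
  The finite type \<open>'m\<close> is the index set \<open>{1, \<dots>, n - 1}\<close>; being non-empty it amounts to
  \<open>n \<ge> 2\<close>.  The index set \<open>{1, \<dots>, n}\<close> is \<open>'m option\<close>, with \<open>None\<close> standing for \<open>n\<close>.

  If \<open>A\<close> is the algebra of Laurent polynomials with exponents in the group \<open>'i\<close>, then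
  \<open>U \<otimes> A\<close> is represented by the finitely supported functions \<open>'i \<Rightarrow>\<^sub>0 'u\<close>, where
  \<open>u \<otimes> t\<^sup>a\<close> is \<open>single a u\<close>.  An element \<open>(u, c)\<close> of \<open>aff\<close> is \<open>u + c K\<^sub>n\<close>, and an element
  \<open>(x, \<delta>)\<close> of \<open>JD\<close> is \<open>x + (\<Sum>i. \<delta>\<^sub>i d\<^sub>i)\<close>.\<close>

type_synonym 'g aff = "(int \<Rightarrow>\<^sub>0 'g) \<times> complex"
type_synonym ('g, 'm) J = "(int ^ 'm) \<Rightarrow>\<^sub>0 'g aff"
type_synonym ('g, 'm) JD = "('g, 'm) J \<times> (complex ^ ('m option))"

text \<open>The biadditive extension of \<open>u \<otimes> t\<^sup>a, v \<otimes> t\<^sup>b \<mapsto> f u v \<otimes> t\<^sup>a\<^sup>+\<^sup>b\<close>.\<close>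

definition laurent_ext ::
    "('a \<Rightarrow> 'b \<Rightarrow> 'c) \<Rightarrow> ('i::plus \<Rightarrow>\<^sub>0 'a::zero) \<Rightarrow> ('i \<Rightarrow>\<^sub>0 'b::zero) \<Rightarrow> ('i \<Rightarrow>\<^sub>0 'c::comm_monoid_add)"
  where "laurent_ext f p q =
    (\<Sum>a\<in>Poly_Mapping.keys p. \<Sum>b\<in>Poly_Mapping.keys q.
       Poly_Mapping.single (a + b) (f (poly_mapping.lookup p a) (poly_mapping.lookup q b)))"

definition aff_bracket ::
    "('g::complex_vector \<Rightarrow> 'g \<Rightarrow> 'g) \<Rightarrow> ('g \<Rightarrow> 'g \<Rightarrow> complex) \<Rightarrow> 'g aff \<Rightarrow> 'g aff \<Rightarrow> 'g aff" where
  "aff_bracket br form X Y =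
     (laurent_ext br (fst X) (fst Y),
      \<Sum>a\<in>Poly_Mapping.keys (fst X).
        of_int a * form (poly_mapping.lookup (fst X) a) (poly_mapping.lookup (fst Y) (- a)))"

text \<open>The derivation \<open>t\<^sub>n \<partial>/\<partial>t\<^sub>n\<close> of \<open>aff\<close>.\<close>

definition aff_deriv :: "'g::complex_vector aff \<Rightarrow> 'g aff" where
  "aff_deriv X = (Poly_Mapping.mapp (\<lambda>a x. of_int a *\<^sub>C x) (fst X), 0)"

text \<open>The derivation of \<open>J\<close> given by the action of \<open>\<Sum>i. \<delta>\<^sub>i d\<^sub>i\<close>.\<close>

definition J_deriv ::
    "complex ^ ('m::finite option) \<Rightarrow> ('g::complex_vector, 'm) J \<Rightarrow> ('g, 'm) J" where
  "J_deriv \<delta> x = Poly_Mapping.mapp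
     (\<lambda>m X. (\<Sum>i\<in>UNIV. \<delta> $ Some i * of_int (m $ i)) *\<^sub>C X + (\<delta> $ None) *\<^sub>C aff_deriv X) x"

definition JD_bracket ::
    "('g::complex_vector \<Rightarrow> 'g \<Rightarrow> 'g) \<Rightarrow> ('g \<Rightarrow> 'g \<Rightarrow> complex) \<Rightarrow>
     ('g, 'm::finite) JD \<Rightarrow> ('g, 'm) JD \<Rightarrow> ('g, 'm) JD" where
  "JD_bracket br form X Y =
     (laurent_ext (aff_bracket br form) (fst X) (fst Y)
        + J_deriv (snd X) (fst Y) - J_deriv (snd Y) (fst X), 0)"

definition aff_elem :: "'g::complex_vector \<Rightarrow> int \<Rightarrow> 'g aff" where
  "aff_elem x a = (Poly_Mapping.single a x, 0)"

definition aff_K :: "'g::complex_vector aff" where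
  "aff_K = (0, 1)"

text \<open>The element \<open>X(m) = X \<otimes> t\<^sup>m\<close> of \<open>J\<close>.\<close>

definition JD_elem :: "'g::complex_vector aff \<Rightarrow> int ^ 'm \<Rightarrow> ('g, 'm::finite) JD" where
  "JD_elem X m = (Poly_Mapping.single m X, 0)"

definition JD_d :: "'m option \<Rightarrow> ('g::complex_vector, 'm::finite) JD" where
  "JD_d i = (0, axis i 1)"

text \<open>For a set \<open>I\<close> of indices, \<open>JD_sub I\<close> is \<open>J \<oplus> D\<^sub>I\<close> and \<open>h_sub H I\<close> is
  \<open>H \<oplus> \<complex>K\<^sub>n \<oplus> D\<^sub>I\<close>, where \<open>D\<^sub>I\<close> is the span of the \<open>d\<^sub>i\<close> with \<open>i \<in> I\<close>.  Thus
  \<open>D\<^sub>0 = D\<close> is the case \<open>I = UNIV\<close>, and \<open>D\<^sub>n\<^sub>-\<^sub>1 = \<complex>d\<^sub>n\<close> the case \<open>I = {None}\<close>.\<close>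

definition JD_sub :: "'m option set \<Rightarrow> ('g::complex_vector, 'm::finite) JD set" where
  "JD_sub I = {X. \<forall>i. i \<notin> I \<longrightarrow> snd X $ i = 0}"

definition h_sub :: "'g::complex_vector set \<Rightarrow> 'm option set \<Rightarrow> ('g, 'm::finite) JD set" where
  "h_sub H I = {JD_elem (aff_elem x 0 + c *\<^sub>C aff_K) 0 + (0, \<delta>) | x c \<delta>.
                  x \<in> H \<and> (\<forall>i. i \<notin> I \<longrightarrow> \<delta> $ i = 0)}"

lemma clinear_0: "clinear f \<Longrightarrow> f 0 = 0"
  unfolding Vector_Spaces.linear_def by (auto dest: module_hom.zero)

lemma cbilinear_0: "cbilinear f \<Longrightarrow> f 0 y = 0" "cbilinear f \<Longrightarrow> f x 0 = 0"
  unfolding cbilinear_def using clinear_0[of "f x"] clinear_0[of "\<lambda>x. f x y"] by auto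

lemma mapp_single:
  "f a 0 = 0 \<Longrightarrow> Poly_Mapping.mapp f (Poly_Mapping.single a x) = Poly_Mapping.single a (f a x)"
  by (auto intro!: poly_mapping_eqI simp: lookup_mapp lookup_single when_def)

lemma scaleC_single: "c *\<^sub>C Poly_Mapping.single a x = Poly_Mapping.single a (c *\<^sub>C x)"
  by (auto intro!: poly_mapping_eqI simp: lookup_single when_def)

lemma sum_axis_Some:
  "(\<Sum>j\<in>UNIV. axis (Some i) (1::complex) $ Some j * f j) = f (i::'m::finite)"
  by (simp add: axis_def if_distrib[of "\<lambda>x. x * _"] cong: if_cong)

lemma axis_None: "axis (None :: 'm::finite option) (1::complex) $ Some j = 0"
  "axis (None :: 'm option) (1::complex) $ None = 1"
  by (simp_all add: axis_def)

lemma axis_Some_None: "axis (Some i :: 'm::finite option) (1::complex) $ None = 0"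
  by (simp add: axis_def)

lemma aff_deriv_0: "aff_deriv 0 = 0"
  by (simp add: aff_deriv_def zero_prod_def poly_mapping_eq_iff fun_eq_iff lookup_mapp)

lemma aff_deriv_K: "aff_deriv aff_K = 0"
  by (simp add: aff_deriv_def aff_K_def zero_prod_def poly_mapping_eq_iff fun_eq_iff lookup_mapp)

lemma J_deriv_0: "J_deriv 0 x = 0" "J_deriv \<delta> 0 = 0"
  by (simp_all add: J_deriv_def poly_mapping_eq_iff fun_eq_iff lookup_mapp)

lemma J_deriv_single:
  "J_deriv \<delta> (Poly_Mapping.single m X) = Poly_Mapping.single m
     ((\<Sum>i\<in>UNIV. \<delta> $ Some i * of_int (m $ i)) *\<^sub>C X + (\<delta> $ None) *\<^sub>C aff_deriv X)"
  by (simp add: J_deriv_def mapp_single aff_deriv_0)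

lemma laurent_ext_0: "laurent_ext f 0 q = 0" "laurent_ext f p 0 = 0"
  by (simp_all add: laurent_ext_def)

lemma laurent_ext_single:
  assumes "\<And>v. f 0 v = 0" "\<And>u. f u 0 = 0"
  shows "laurent_ext f (Poly_Mapping.single a u) (Poly_Mapping.single b v) =
    Poly_Mapping.single (a + b) (f u v)"
  using assms by (simp add: laurent_ext_def)

lemma aff_bracket_elem:
  assumes "cbilinear br" "cbilinear form"
  shows "aff_bracket br form (aff_elem x a) (aff_elem y b) =
    aff_elem (br x y) (a + b) + (if a + b = 0 then of_int a * form x y else 0) *\<^sub>C aff_K"
  using assms by (auto simp: aff_bracket_def aff_elem_def aff_K_def laurent_ext_single cbilinear_0
      scaleC_prod_def scaleC_complex_def lookup_single when_def prod_eq_iff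
      poly_mapping_eq_iff fun_eq_iff eq_neg_iff_add_eq_0 add.commute)

lemma aff_bracket_K:
  assumes "cbilinear form"
  shows "aff_bracket br form aff_K X = 0" "aff_bracket br form X aff_K = 0"
  using assms by (simp_all add: aff_bracket_def aff_K_def laurent_ext_def cbilinear_0 prod_eq_iff)

lemma JD_bracket_elem:
  assumes "cbilinear br" "cbilinear form"
  shows "JD_bracket br form (JD_elem X a) (JD_elem Y b) =
    JD_elem (aff_bracket br form X Y) (a + b)"
proof -
  have "aff_bracket br form 0 v = 0" "aff_bracket br form v 0 = 0" for v
    using assms by (auto simp: aff_bracket_def laurent_ext_def cbilinear_0 prod_eq_iff)
  then show ?thesis
    by (simp add: JD_bracket_def JD_elem_def laurent_ext_single J_deriv_0)
qed

lemma JD_bracket_d_elem: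
  fixes a :: "int ^ 'm::finite"
  shows "JD_bracket br form (JD_d (Some i)) (JD_elem X a) = of_int (a $ i) *\<^sub>C JD_elem X a"
    and "JD_bracket br form (JD_d None) (JD_elem (aff_elem x b) a) =
      of_int b *\<^sub>C JD_elem (aff_elem x b) a"
    and "JD_bracket br form (JD_d None) (JD_elem aff_K a) = 0"
proof -
  have "aff_deriv (aff_elem x b) = of_int b *\<^sub>C aff_elem x b"
    by (simp add: aff_deriv_def aff_elem_def mapp_single scaleC_single scaleC_prod_def)
  then show "JD_bracket br form (JD_d (Some i)) (JD_elem X a) = of_int (a $ i) *\<^sub>C JD_elem X a"
    "JD_bracket br form (JD_d None) (JD_elem (aff_elem x b) a) =
      of_int b *\<^sub>C JD_elem (aff_elem x b) a"
    "JD_bracket br form (JD_d None) (JD_elem aff_K a) = 0"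
    by (simp_all add: JD_bracket_def JD_elem_def JD_d_def J_deriv_0 laurent_ext_0 J_deriv_single
        sum_axis_Some axis_None axis_Some_None scaleC_prod_def[of _ "(_, _)"] scaleC_single
        scaleC_one aff_deriv_K zero_prod_def[symmetric])
qed

section \<open>Modules\<close>

text \<open>A module over a Lie subalgebra \<open>L\<close> of the ambient Lie algebra with bracket \<open>br\<close>; only
  the values \<open>act X\<close> with \<open>X \<in> L\<close> are relevant.\<close>

definition lie_module ::
    "('l::complex_vector \<Rightarrow> 'l \<Rightarrow> 'l) \<Rightarrow> 'l set \<Rightarrow> ('l \<Rightarrow> 'v \<Rightarrow> 'v::complex_vector) \<Rightarrow> bool" where
  "lie_module br L act \<longleftrightarrow>
     (\<forall>X\<in>L. clinear (act X)) \<and>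
     (\<forall>X\<in>L. \<forall>Y\<in>L. \<forall>v. act (X + Y) v = act X v + act Y v) \<and>
     (\<forall>c. \<forall>X\<in>L. \<forall>v. act (c *\<^sub>C X) v = c *\<^sub>C act X v) \<and>
     (\<forall>X\<in>L. \<forall>Y\<in>L. \<forall>v. act (br X Y) v = act X (act Y v) - act Y (act X v))"

definition submodule :: "'l set \<Rightarrow> ('l \<Rightarrow> 'v \<Rightarrow> 'v::complex_vector) \<Rightarrow> 'v set \<Rightarrow> bool" where
  "submodule L act S \<longleftrightarrow> csubspace S \<and> (\<forall>X\<in>L. \<forall>v\<in>S. act X v \<in> S)"

definition irreducible_submodule ::
    "'l set \<Rightarrow> ('l \<Rightarrow> 'v \<Rightarrow> 'v::complex_vector) \<Rightarrow> 'v set \<Rightarrow> bool" where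
  "irreducible_submodule L act S \<longleftrightarrow>
     submodule L act S \<and> S \<noteq> {0} \<and>
     (\<forall>T. submodule L act T \<and> T \<subseteq> S \<longrightarrow> T = {0} \<or> T = S)"

definition irreducible_module ::
    "('l::complex_vector \<Rightarrow> 'l \<Rightarrow> 'l) \<Rightarrow> 'l set \<Rightarrow> ('l \<Rightarrow> 'v \<Rightarrow> 'v::complex_vector) \<Rightarrow> bool" where
  "irreducible_module br L act \<longleftrightarrow>
     lie_module br L act \<and> irreducible_submodule L act UNIV"

definition maximal_submodule ::
    "'l set \<Rightarrow> ('l \<Rightarrow> 'v \<Rightarrow> 'v::complex_vector) \<Rightarrow> 'v set \<Rightarrow> bool" where
  "maximal_submodule L act W \<longleftrightarrow>
     submodule L act W \<and> W \<noteq> UNIV \<and>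
     (\<forall>T. submodule L act T \<and> W \<subseteq> T \<longrightarrow> T = W \<or> T = UNIV)"

definition completely_reducible ::
    "'l set \<Rightarrow> ('l \<Rightarrow> 'v \<Rightarrow> 'v::complex_vector) \<Rightarrow> bool" where
  "completely_reducible L act \<longleftrightarrow>
     (\<exists>\<S>. (\<forall>S\<in>\<S>. irreducible_submodule L act S) \<and> direct_sum_decomposition \<S>)"

text \<open>\<open>'w\<close> is the quotient \<open>L\<close>-module \<open>V / W\<close>, with canonical projection \<open>q\<close>.  As
  \<open>V / W\<close> depends on the set \<open>W\<close> it cannot be a type of its own; its elements correspond to
  the cosets \<open>v + W\<close> via \<open>q\<close>, and all operations of \<open>'w\<close> are the induced ones.\<close>

definition quotient_module ::
    "'l set \<Rightarrow> ('l \<Rightarrow> 'v \<Rightarrow> 'v::complex_vector) \<Rightarrow> 'v set \<Rightarrow>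
     ('l \<Rightarrow> 'w \<Rightarrow> 'w::complex_vector) \<Rightarrow> ('v \<Rightarrow> 'w) \<Rightarrow> bool" where
  "quotient_module L act W act' q \<longleftrightarrow>
     clinear q \<and> surj q \<and> {v. q v = 0} = W \<and> (\<forall>X\<in>L. \<forall>v. q (act X v) = act' X (q v))"

definition weight_space ::
    "'l set \<Rightarrow> ('l \<Rightarrow> 'v \<Rightarrow> 'v::complex_vector) \<Rightarrow> ('l \<Rightarrow> complex) \<Rightarrow> 'v set" where
  "weight_space T act \<mu> = {v. \<forall>h\<in>T. act h v = \<mu> h *\<^sub>C v}"

definition weight_module :: "'l set \<Rightarrow> ('l \<Rightarrow> 'v \<Rightarrow> 'v::complex_vector) \<Rightarrow> bool" where
  "weight_module T act \<longleftrightarrow> direct_sum_decomposition {weight_space T act \<mu> | \<mu>. True}"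

definition finite_dim_weight_spaces ::
    "'l set \<Rightarrow> ('l \<Rightarrow> 'v \<Rightarrow> 'v::complex_vector) \<Rightarrow> bool" where
  "finite_dim_weight_spaces T act \<longleftrightarrow> (\<forall>\<mu>. finite_dim (weight_space T act \<mu>))"

section \<open>Central operators\<close>

text \<open>Products of operators by which elements \<open>K\<^sub>n \<otimes> t\<^sup>m\<close> with non-zero action act, and of
  (two-sided) inverses of such operators.\<close>

inductive central_product ::
    "(('g::complex_vector, 'm::finite) JD \<Rightarrow> 'v \<Rightarrow> 'v::complex_vector) \<Rightarrow> ('v \<Rightarrow> 'v) \<Rightarrow> bool"
  for act where
  one: "central_product act id"
| factor: "central_product act z \<Longrightarrow> act (JD_elem aff_K m) \<noteq> (\<lambda>v. 0) \<Longrightarrow>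
    central_product act (act (JD_elem aff_K m) \<circ> z)"
| inverse: "central_product act z \<Longrightarrow> act (JD_elem aff_K m) \<noteq> (\<lambda>v. 0) \<Longrightarrow>
    act (JD_elem aff_K m) \<circ> u = id \<Longrightarrow> u \<circ> act (JD_elem aff_K m) = id \<Longrightarrow>
    central_product act (u \<circ> z)"

definition central_operator ::
    "(('g::complex_vector, 'm::finite) JD \<Rightarrow> 'v \<Rightarrow> 'v::complex_vector) \<Rightarrow> ('v \<Rightarrow> 'v) \<Rightarrow> bool" where
  "central_operator act z \<longleftrightarrow> (\<exists>c y. central_product act y \<and> z = (\<lambda>v. c *\<^sub>C y v))"

definition has_degree ::
    "(('g::complex_vector, 'm::finite) JD \<Rightarrow> 'v \<Rightarrow> 'v::complex_vector) \<Rightarrow> ('v \<Rightarrow> 'v) \<Rightarrow>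
     int ^ ('m option) \<Rightarrow> bool" where
  "has_degree act z m \<longleftrightarrow>
     (\<forall>i v. act (JD_d i) (z v) - z (act (JD_d i) v) = of_int (m $ i) *\<^sub>C z v)"

section \<open>The module \<open>\<pi>(\<alpha>)\<close> on \<open>V\<^sub>1 \<otimes> A\<^sub>n\<^sub>-\<^sub>1\<close>\<close>

text \<open>The first summand is the action of \<open>J\<close>; the second is the action of \<open>\<Sum>i. \<delta>\<^sub>i d\<^sub>i\<close>.\<close>

definition pi_act ::
    "complex ^ 'm \<Rightarrow> (('g::complex_vector, 'm::finite) JD \<Rightarrow> 'w \<Rightarrow> 'w::complex_vector) \<Rightarrow>
     ('g, 'm) JD \<Rightarrow> ((int ^ 'm) \<Rightarrow>\<^sub>0 'w) \<Rightarrow> ((int ^ 'm) \<Rightarrow>\<^sub>0 'w)" where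
  "pi_act \<alpha> act X f =
     (\<Sum>m\<in>Poly_Mapping.keys (fst X). \<Sum>p\<in>Poly_Mapping.keys f.
        Poly_Mapping.single (m + p)
          (act (JD_elem (poly_mapping.lookup (fst X) m) m) (poly_mapping.lookup f p)))
     + Poly_Mapping.mapp (\<lambda>p v. (\<Sum>i\<in>UNIV. snd X $ Some i * (\<alpha> $ i + of_int (p $ i))) *\<^sub>C v
         + (snd X $ None) *\<^sub>C act (JD_d None) v) f"

lemma pi_act_elem:
  assumes "act (JD_elem 0 m) = (\<lambda>v. 0)" "clinear (act (JD_elem X m))"
  shows "pi_act \<alpha> act (JD_elem X m) (Poly_Mapping.single p v) =
    Poly_Mapping.single (m + p) (act (JD_elem X m) v)"
  using assms clinear_0[OF assms(2)]
  by (auto simp: pi_act_def JD_elem_def mapp_single)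

lemma pi_act_d:
  assumes "clinear (act (JD_d None))"
  shows "pi_act \<alpha> act (JD_d (Some i)) (Poly_Mapping.single p v) =
      (\<alpha> $ i + of_int (p $ i)) *\<^sub>C Poly_Mapping.single p v"
    and "pi_act \<alpha> act (JD_d None) (Poly_Mapping.single p v) =
      Poly_Mapping.single p (act (JD_d None) v)"
  using clinear_0[OF assms]
  by (simp_all add: pi_act_def JD_d_def mapp_single sum_axis_Some scaleC_single scaleC_one
      axis_None axis_Some_None)

end

(* Each K_n(m) = K_n \<otimes> t^m acts on V_1 by a scalar c(m) (Schur).  Since weight spaces are finite
   dimensional, some nontrivial combination f of powers of t^m makes x \<otimes> t_n^a \<otimes> f vanish on a given
   finite sum of weight spaces; commuting with y \<otimes> t_n^(-a) \<otimes> t^s for a = 0, 1 and subtracting gives a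
   linear recurrence for j \<mapsto> c(j m).  Hence c(m) \<noteq> 0 forces c(-i m) \<noteq> 0 for some i > 0, so the set of
   r such that t^r preserves all submodules of V_1 \<otimes> A is closed under -m as well as m whenever
   c(m) \<noteq> 0.  It therefore contains the degrees \<plusminus>k_i e_i of the central operators.  Submodules are
   graded by Z^(n-1) and k-periodic, so they are detected on one weight space of V_1 over a finite box
   of exponents; by finite dimensionality an irreducible submodule S exists.  The homogeneous
   components of S span a nonzero submodule of V_1, which is V_1, so the finitely many translates t^r S
   with r in the box sum to V_1 \<otimes> A. *)

theory Submission
  imports Defs "HOL-Computational_Algebra.Fundamental_Theorem_Algebra"
begin

section \<open>Linear algebra\<close>

text \<open>The obstacle is the inverse operators among the factors of a central operator. On V they
  exist because a non-zero K_n(m) is bijective. But V_1 \<otimes> A is infinite dimensional and in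
  general not irreducible, so a submodule stable under t^m need not be stable under t^(-m), and c(m)
  \<noteq> 0 says nothing directly about c(-m). A single negative multiple suffices, since t^(-m) is
  the product of t^(-im) and t^((i-1)m).

  The recurrence rests on a uniformity: h_(n-1) contains none of d_1, ..., d_(n-1), so its weights
  do not see the exponent m, and for fixed x and a all x \<otimes> t_n^a \<otimes> t^m carry a given
  weight space into one and the same finite sum of weight spaces. For the same reason one relation
  serves all s. No root vectors are used: the finite sum is found for arbitrary x from a polynomial
  relation for each torus element acting on g.

  V and V_1 are linked only through c: if K_n(m) is non-zero on V then it is onto, and c(m) = 0
  would force W = V. So the degree of a central operator is a sum of exponents \<plusminus>m with
  c(m) \<noteq> 0.\<close>

lemma clinear_module_hom: "clinear f \<Longrightarrow> module_hom scaleC scaleC f"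
  by (simp add: Vector_Spaces.linear_def)

lemma clinear_add: "clinear f \<Longrightarrow> f (x + y) = f x + f y"
  by (rule module_hom.add[OF clinear_module_hom])

lemma clinear_scale: "clinear f \<Longrightarrow> f (c *\<^sub>C x) = c *\<^sub>C f x"
  by (rule module_hom.scale[OF clinear_module_hom])

lemma clinear_diff: "clinear f \<Longrightarrow> f (x - y) = f x - f y"
  by (rule module_hom.diff[OF clinear_module_hom])

lemma clinear_sum: "clinear f \<Longrightarrow> f (sum g A) = (\<Sum>a\<in>A. f (g a))"
  by (rule module_hom.sum[OF clinear_module_hom])

lemma clinearI:
  assumes "\<And>x y. f (x + y) = f x + f y" "\<And>c x. f (c *\<^sub>C x) = c *\<^sub>C f x"
  shows "clinear f"
  using assms by unfold_locales

lemma subspace_vimage: "clinear f \<Longrightarrow> csubspace S \<Longrightarrow> csubspace {x. f x \<in> S}"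
  by (auto simp: complex_vector.subspace_def clinear_0 clinear_add clinear_scale)

lemma subspace_kernel: "clinear f \<Longrightarrow> csubspace {x. f x = 0}"
  using subspace_vimage[OF _ complex_vector.subspace_single_0] by simp

lemma subspace_range: "clinear f \<Longrightarrow> csubspace (range f)"
  unfolding complex_vector.subspace_def
  by (auto simp: image_iff) (metis clinear_0 clinear_add clinear_scale)+

lemma span_image_clinear: "clinear f \<Longrightarrow> cspan (f ` S) = f ` cspan S"
  unfolding cspan_def by (rule module_hom.span_image[OF clinear_module_hom])

section \<open>Finite dimensional subspaces and linear relations\<close>

lemma finite_dim_subset: "finite_dim T \<Longrightarrow> S \<subseteq> T \<Longrightarrow> finite_dim S"
  unfolding finite_dim_def by blast

lemma finite_dim_Union:
  assumes "finite M" "\<And>S. S \<in> M \<Longrightarrow> finite_dim S"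
  shows "finite_dim (cspan (\<Union>M))"
proof -
  obtain B where B: "\<And>S. S \<in> M \<Longrightarrow> finite (B S) \<and> S \<subseteq> cspan (B S)"
    using assms(2) unfolding finite_dim_def by metis
  have "finite (\<Union>S\<in>M. B S)" using assms(1) B by blast
  moreover have "S \<subseteq> cspan (\<Union>S\<in>M. B S)" if "S \<in> M" for S
    using B[OF that] complex_vector.span_mono[of "B S" "\<Union>S\<in>M. B S"] that by blast
  then have "cspan (\<Union>M) \<subseteq> cspan (\<Union>S\<in>M. B S)"
    by (intro complex_vector.span_minimal) (auto simp: complex_vector.subspace_span)
  ultimately show ?thesis unfolding finite_dim_def by blast
qed

text \<open>Here the spanning set lies in \<open>S\<close> itself, so that what is known about the
  members of \<open>S\<close> (torus elements, vectors of a sum of weight spaces) applies to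
  it.\<close>

lemma finite_dim_finite_spanning:
  assumes "finite_dim S"
  obtains B where "finite B" "B \<subseteq> S" "S \<subseteq> cspan B"
proof -
  obtain C where C: "finite C" "S \<subseteq> cspan C" using assms finite_dim_def by blast
  obtain B where "B \<subseteq> S" "\<not> complex_vector.dependent B" "S \<subseteq> cspan B"
    using complex_vector.maximal_independent_subset by blast
  with complex_vector.independent_span_bound[OF C(1)] C(2) that show thesis by blast
qed

text \<open>Any \<open>card B + 1\<close> vectors in the span of \<open>B\<close> are related.
  Dependence is a property of sets, so a sequence that repeats a vector is treated apart, by the
  relation \<open>u i - u j = 0\<close>.\<close>

lemma sequence_relation:
  fixes u :: "nat \<Rightarrow> 'a::complex_vector"
  assumes "finite B" and u: "\<And>j. u j \<in> cspan B"
  shows "\<exists>N a. (\<exists>j\<le>N. a j \<noteq> 0) \<and> (\<Sum>j\<le>N. a j *\<^sub>C u j) = 0"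
proof -
  let ?N = "card B"
  show ?thesis
  proof (cases "inj_on u {..?N}")
    case True
    then have card: "card (u ` {..?N}) = Suc ?N" by (simp add: card_image)
    have "complex_vector.dependent (u ` {..?N})"
      using complex_vector.independent_span_bound[OF assms(1), of "u ` {..?N}"] u card by force
    then obtain c where c: "\<exists>v\<in>u ` {..?N}. c v \<noteq> 0" "(\<Sum>v\<in>u ` {..?N}. c v *\<^sub>C v) = 0"
      using complex_vector.dependent_finite[of "u ` {..?N}"] by auto
    have "(\<Sum>j\<le>?N. c (u j) *\<^sub>C u j) = 0"
      using c(2) by (simp add: sum.reindex[OF True])
    with c(1) show ?thesis by (intro exI[of _ ?N] exI[of _ "c \<circ> u"]) auto
  next
    case False
    then obtain i j where ij: "i \<le> ?N" "j \<le> ?N" "i \<noteq> j" "u i = u j"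
      by (auto simp: inj_on_def)
    let ?a = "\<lambda>l. if l = i then 1 else if l = j then -1 else (0::complex)"
    have "(\<Sum>l\<le>?N. ?a l *\<^sub>C u l) = (\<Sum>l\<in>{i, j}. ?a l *\<^sub>C u l)"
      using ij by (intro sum.mono_neutral_right) auto
    also have "\<dots> = 0" using ij by (simp add: scaleC_one complex_vector.scale_minus_left)
    finally show ?thesis using ij by (intro exI[of _ ?N] exI[of _ ?a]) auto
  qed
qed

text \<open>Packing the sequences as the coordinates of one sequence in the direct sum
  \<open>'i \<Rightarrow>\<^sub>0 'a\<close> gives coefficients that do not depend on
  \<open>i\<close>.\<close>

lemma sequences_relation:
  fixes u :: "'i \<Rightarrow> nat \<Rightarrow> 'a::complex_vector"
  assumes "finite I" and "finite B" and u: "\<And>i j. i \<in> I \<Longrightarrow> u i j \<in> cspan B"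
  shows "\<exists>N a. (\<exists>j\<le>N. a j \<noteq> 0) \<and> (\<forall>i\<in>I. (\<Sum>j\<le>N. a j *\<^sub>C u i j) = 0)"
proof -
  let ?U = "\<lambda>j. \<Sum>i\<in>I. Poly_Mapping.single i (u i j)"
  let ?B = "\<Union>i\<in>I. Poly_Mapping.single i ` B"
  have lin: "clinear (Poly_Mapping.single i :: 'a \<Rightarrow> 'i \<Rightarrow>\<^sub>0 'a)" for i
    by (rule clinearI) (simp_all add: single_add scaleC_single)
  have lookup: "poly_mapping.lookup (?U j) i = u i j" if "i \<in> I" for i j
    using that assms(1) by (simp add: lookup_sum lookup_single when_def)
  have "Poly_Mapping.single i (u i j) \<in> cspan ?B" if "i \<in> I" for i j
    using u[OF that] span_image_clinear[OF lin, of i B] that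
      complex_vector.span_mono[of "Poly_Mapping.single i ` B" ?B] by blast
  then have "?U j \<in> cspan ?B" for j
    by (intro complex_vector.span_sum)
  moreover have "finite ?B" using assms by blast
  ultimately obtain N a where Na: "\<exists>j\<le>N. a j \<noteq> 0" "(\<Sum>j\<le>N. a j *\<^sub>C ?U j) = 0"
    using sequence_relation[of ?B ?U] by blast
  have "(\<Sum>j\<le>N. a j *\<^sub>C u i j) = poly_mapping.lookup (\<Sum>j\<le>N. a j *\<^sub>C ?U j) i"
    if "i \<in> I" for i
    using lookup[OF that] by (simp add: lookup_sum)
  then have "\<forall>i\<in>I. (\<Sum>j\<le>N. a j *\<^sub>C u i j) = 0"
    using Na(2) by simp
  with Na(1) show ?thesis by blast
qed

section \<open>Eigenvectors of operators on finite dimensional stable subspaces\<close>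

lemma clinear_funpow:
  fixes T :: "'a::complex_vector \<Rightarrow> 'a"
  shows "clinear T \<Longrightarrow> clinear (T ^^ j)"
proof (induction j)
  case 0
  show ?case by (rule clinearI) simp_all
next
  case (Suc j)
  then show ?case by (intro clinearI) (simp_all add: clinear_add clinear_scale)
qed

definition poly_op :: "('a::complex_vector \<Rightarrow> 'a) \<Rightarrow> complex poly \<Rightarrow> 'a \<Rightarrow> 'a" where
  "poly_op T p v = (\<Sum>j\<le>degree p. coeff p j *\<^sub>C (T ^^ j) v)"

lemma poly_op_0 [simp]: "poly_op T 0 v = 0"
  by (simp add: poly_op_def)

lemma poly_op_pCons:
  assumes "clinear T"
  shows "poly_op T (pCons a q) v = a *\<^sub>C v + T (poly_op T q v)"
proof (cases "q = 0")
  case True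
  then show ?thesis using clinear_0[OF assms] by (simp add: poly_op_def)
next
  case False
  then show ?thesis
    by (simp add: poly_op_def sum.atMost_Suc_shift clinear_sum[OF assms] clinear_scale[OF assms]
      del: sum.atMost_Suc)
qed

lemma poly_op_add: "clinear T \<Longrightarrow> poly_op T (p + q) v = poly_op T p v + poly_op T q v"
proof (induction p q rule: poly_induct2)
  case (pCons a p b q)
  then show ?case by (simp add: poly_op_pCons clinear_add scaleC_add_left algebra_simps)
qed simp

lemma poly_op_smult: "clinear T \<Longrightarrow> poly_op T (smult c p) v = c *\<^sub>C poly_op T p v"
proof (induction p)
  case (pCons a p)
  then show ?case
    by (simp add: poly_op_pCons clinear_scale scaleC_add_right scaleC_scaleC)
qed simp

text \<open>Over the complex numbers a linear factor splits off, p = (X - c) r. Then r(T) v is an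
  eigenvector for c unless it is zero, and in that case \<open>r\<close> annihilates
  \<open>v\<close> and has smaller degree.\<close>

lemma poly_op_eigenvector:
  assumes "clinear T" "p \<noteq> 0" "poly_op T p v = 0" "v \<noteq> 0" "csubspace U" "v \<in> U"
    and U: "\<And>x. x \<in> U \<Longrightarrow> T x \<in> U"
  shows "\<exists>c. \<exists>w\<in>U. w \<noteq> 0 \<and> T w = c *\<^sub>C w"
  using assms(2,3)
proof (induction "degree p" arbitrary: p)
  case 0
  then obtain a where "p = [:a:]" using degree_eq_zeroE by metis
  with 0 assms(4) clinear_0[OF assms(1)] show ?case by (simp add: poly_op_def)
next
  case (Suc n)
  then have "\<not> constant (poly p)" by (simp add: constant_degree)
  then obtain c where "poly p c = 0" using fundamental_theorem_of_algebra by blast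
  then obtain r where r: "p = [:- c, 1:] * r" using poly_eq_0_iff_dvd by blast
  have "r \<noteq> 0" using Suc r by auto
  have deg: "degree r = n" using Suc(2) \<open>r \<noteq> 0\<close> unfolding r by (subst (asm) degree_mult_eq) auto
  let ?w = "poly_op T r v"
  have p: "p = smult (- c) r + pCons 0 r" unfolding r by simp
  have "poly_op T p v = T ?w - c *\<^sub>C ?w"
    by (simp only: p poly_op_add poly_op_smult poly_op_pCons assms(1)) simp
  then have "T ?w = c *\<^sub>C ?w" using Suc(4) by simp
  moreover have "(T ^^ j) v \<in> U" for j by (induction j) (auto simp: U assms)
  then have "?w \<in> U"
    unfolding poly_op_def using assms(5)
    by (intro complex_vector.subspace_sum complex_vector.subspace_scale) auto
  ultimately show ?case using Suc(1)[OF deg[symmetric] \<open>r \<noteq> 0\<close>] by blast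
qed

lemma finite_dim_eigenvector:
  assumes T: "clinear T" and U: "csubspace U" "finite_dim U" "U \<noteq> {0}"
    and stable: "\<And>x. x \<in> U \<Longrightarrow> T x \<in> U"
  shows "\<exists>c. \<exists>w\<in>U. w \<noteq> 0 \<and> T w = c *\<^sub>C w"
proof -
  obtain v where v: "v \<in> U" "v \<noteq> 0"
    using U(1,3) complex_vector.subspace_0 by blast
  obtain B where B: "finite B" "U \<subseteq> cspan B" using U(2) finite_dim_def by blast
  have "(T ^^ j) v \<in> U" for j by (induction j) (auto simp: stable v)
  then obtain N a where Na: "\<exists>j\<le>N. a j \<noteq> 0" "(\<Sum>j\<le>N. a j *\<^sub>C (T ^^ j) v) = 0"
    using sequence_relation[OF B(1), of "\<lambda>j. (T ^^ j) v"] B(2) by blast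
  \<comment> \<open>The last coefficients of the relation may vanish, so the degree of
    \<open>p\<close> can be smaller than \<open>N\<close>.\<close>
  define p where "p = (\<Sum>j\<le>N. monom (a j) j)"
  have coeff: "coeff p j = (if j \<le> N then a j else 0)" for j
    unfolding p_def by (simp add: coeff_sum)
  have "p \<noteq> 0" using Na(1) coeff by (metis coeff_0)
  have "degree p \<le> N" by (rule degree_le) (simp add: coeff)
  then have "poly_op T p v = (\<Sum>j\<le>N. coeff p j *\<^sub>C (T ^^ j) v)"
    unfolding poly_op_def by (intro sum.mono_neutral_left) (auto simp: coeff_eq_0)
  also have "\<dots> = 0" using Na(2) by (simp add: coeff)
  finally show ?thesis
    using poly_op_eigenvector[OF T \<open>p \<noteq> 0\<close> _ v(2) U(1) v(1)] stable by blast
qed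

text \<open>If \<open>b\<close> separates \<open>i\<close> from \<open>j\<close>, the operator T_b -
  e_j(b) removes the summand \<open>j\<close> and multiplies the summand \<open>i\<close> by a
  non-zero scalar, so summands can be discarded until only \<open>i\<close> is left. This serves
  both the weights of V_1 and the grading by the exponents of t_1, ..., t_(n-1).\<close>

lemma stable_subspace_components:
  fixes T :: "'b \<Rightarrow> 'a::complex_vector \<Rightarrow> 'a"
  assumes S: "csubspace S" and T: "\<And>b. b \<in> B \<Longrightarrow> clinear (T b)"
    and stable: "\<And>b x. b \<in> B \<Longrightarrow> x \<in> S \<Longrightarrow> T b x \<in> S"
    and "finite M"
    and eig: "\<And>b i. b \<in> B \<Longrightarrow> i \<in> M \<Longrightarrow> T b (w i) = e i b *\<^sub>C w i"
    and dist: "\<And>i j. i \<in> M \<Longrightarrow> j \<in> M \<Longrightarrow> i \<noteq> j \<Longrightarrow> \<exists>b\<in>B. e i b \<noteq> e j b"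
    and "sum w M \<in> S" and "i \<in> M"
  shows "w i \<in> S"
  using assms(4-)
proof (induction M arbitrary: w i rule: finite_psubset_induct)
  case (psubset M)
  show ?case
  proof (cases "M = {i}")
    case True
    then show ?thesis using psubset.prems by simp
  next
    case False
    then obtain j where j: "j \<in> M" "j \<noteq> i" using psubset.prems(4) by blast
    then obtain b where b: "b \<in> B" "e i b \<noteq> e j b" using psubset.prems(2,4) by metis
    let ?w = "\<lambda>l. (e l b - e j b) *\<^sub>C w l"
    have "(\<Sum>l\<in>M. ?w l) = T b (sum w M) - e j b *\<^sub>C sum w M"
      using psubset.prems(1)[OF b(1)]
      by (simp add: clinear_sum[OF T[OF b(1)]] complex_vector.scale_left_diff_distrib
          sum_subtractf complex_vector.scale_sum_right)
    moreover have "(\<Sum>l\<in>M. ?w l) = (\<Sum>l\<in>M - {j}. ?w l)"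
      using psubset.hyps j(1) by (simp add: sum.remove)
    ultimately have in_S: "(\<Sum>l\<in>M - {j}. ?w l) \<in> S"
      using stable[OF b(1)] psubset.prems(3) S
      by (simp add: complex_vector.subspace_diff complex_vector.subspace_scale)
    have "?w i \<in> S"
    proof (rule psubset.IH[of "M - {j}"])
      show "T b' (?w l) = e l b' *\<^sub>C ?w l" if "b' \<in> B" "l \<in> M - {j}" for b' l
        using psubset.prems(1) that by (simp add: clinear_scale[OF T] scaleC_scaleC mult.commute)
    qed (use j psubset.prems in_S in auto)
    then have "inverse (e i b - e j b) *\<^sub>C ?w i \<in> S"
      by (rule complex_vector.subspace_scale[OF S])
    then show ?thesis using b(2) by (simp add: scaleC_scaleC scaleC_one)
  qed
qed

lemma mem_span_Union_sum:
  assumes "x \<in> cspan (\<Union>\<S>)" and sub: "\<And>S. S \<in> \<S> \<Longrightarrow> csubspace S"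
  shows "\<exists>M w. finite M \<and> M \<subseteq> \<S> \<and> (\<forall>S\<in>M. w S \<in> S) \<and> x = sum w M"
  using assms(1)
proof (induction rule: complex_vector.span_induct_alt)
  case base
  show ?case by (intro exI[of _ "{}"]) simp
next
  case (step c x y)
  then obtain M w S where Mw: "finite M" "M \<subseteq> \<S>" "\<forall>S\<in>M. w S \<in> S" "y = sum w M"
    and S: "S \<in> \<S>" "x \<in> S" by blast
  \<comment> \<open>The vector \<open>c *\<^sub>C x\<close> joins the summand of \<open>S\<close> if
    there is one and opens it otherwise; the default value 0 merges the two cases.\<close>
  let ?w = "\<lambda>R. (if R \<in> M then w R else 0) + (if R = S then c *\<^sub>C x else 0)"
  have "sum ?w (insert S M) = (\<Sum>R\<in>insert S M. if R \<in> M then w R else 0)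
      + (\<Sum>R\<in>insert S M. if R = S then c *\<^sub>C x else 0)"
    by (rule sum.distrib)
  also have "(\<Sum>R\<in>insert S M. if R \<in> M then w R else 0) = sum w M"
    using Mw(1) by (intro sum.mono_neutral_cong_right) auto
  also have "(\<Sum>R\<in>insert S M. if R = S then c *\<^sub>C x else 0) = c *\<^sub>C x"
    using Mw(1) by simp
  finally have "c *\<^sub>C x + y = sum ?w (insert S M)" using Mw(4) by (simp add: add.commute)
  moreover have "?w R \<in> R" if "R \<in> insert S M" for R
    using that Mw(2,3) S sub[of R]
    by (auto intro!: complex_vector.subspace_add complex_vector.subspace_scale
        simp: complex_vector.subspace_0)
  ultimately show ?case using Mw(1,2) S(1) by (intro exI[of _ "insert S M"] exI[of _ ?w]) auto
qed

section \<open>The Lie algebra\<close>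

lemma JD_elem_add: "JD_elem (X + Y) m = JD_elem X m + JD_elem Y m"
  by (simp add: JD_elem_def single_add)

lemma JD_elem_scale: "JD_elem (c *\<^sub>C X) m = c *\<^sub>C JD_elem X m"
  by (simp add: JD_elem_def scaleC_single scaleC_prod_def[of _ "(_, _)"])

lemma aff_elem_add: "aff_elem (x + y) a = aff_elem x a + aff_elem y a"
  by (simp add: aff_elem_def single_add)

lemma aff_elem_scale: "aff_elem (c *\<^sub>C x) a = c *\<^sub>C aff_elem x a"
  by (simp add: aff_elem_def scaleC_single scaleC_prod_def)

lemma JD_elem_in_JD_sub: "JD_elem X m \<in> JD_sub I"
  by (simp add: JD_elem_def JD_sub_def)

lemma JD_d_in_JD_sub: "JD_d i \<in> JD_sub I \<longleftrightarrow> i \<in> I"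
  by (auto simp: JD_d_def JD_sub_def axis_def)

lemma subspace_JD_sub: "csubspace (JD_sub I)"
  by (auto simp: complex_vector.subspace_def JD_sub_def scaleC_prod_def scaleC_vec_def)

lemma h_sub_subset: "h_sub H I \<subseteq> JD_sub I"
  by (auto simp: h_sub_def JD_sub_def JD_elem_def)

lemma JD_decomposition:
  fixes X :: "('g::complex_vector, 'm::finite) JD"
  shows "X = (\<Sum>m\<in>Poly_Mapping.keys (fst X). JD_elem (poly_mapping.lookup (fst X) m) m) + (0, snd X)"
proof -
  let ?S = "\<Sum>m\<in>Poly_Mapping.keys (fst X). Poly_Mapping.single m (poly_mapping.lookup (fst X) m)"
  have "poly_mapping.lookup ?S k = poly_mapping.lookup (fst X) k" for k
    by (simp add: lookup_sum lookup_single when_def in_keys_iff)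
  then have "?S = fst X" by (rule poly_mapping_eqI)
  then have "(\<Sum>m\<in>Poly_Mapping.keys (fst X). JD_elem (poly_mapping.lookup (fst X) m) m) = (fst X, 0)"
    by (simp add: JD_elem_def prod_eq_iff fst_sum snd_sum)
  then show ?thesis by (simp add: prod_eq_iff)
qed

lemma JD_sub_None_deriv:
  fixes X :: "('g::complex_vector, 'm::finite) JD"
  assumes "X \<in> JD_sub {None}"
  shows "(0, snd X) = (snd X $ None) *\<^sub>C (JD_d None :: ('g, 'm) JD)"
proof -
  have "snd X $ i = snd X $ None * axis None 1 $ i" for i
    using assms by (cases i) (simp_all add: JD_sub_def axis_def)
  then have "snd X = (snd X $ None) *\<^sub>C axis None 1"
    unfolding vec_eq_iff scaleC_vec_def scaleC_complex_def vec_lambda_beta by blast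
  then show ?thesis by (simp add: JD_d_def scaleC_prod_def)
qed

text \<open>K_n is central in the affine algebra and has degree 0 in t_n, so only the components of
  \<open>X\<close> along d_1, ..., d_(n-1) contribute. On J \<oplus> D_(n-1) the scalar is 0 and
  K_n(m) is central; on J \<oplus> D it is merely an eigenvector.\<close>

lemma JD_bracket_K:
  fixes X :: "('g::complex_vector, 'm::finite) JD"
  assumes "cbilinear form"
  shows "JD_bracket br form X (JD_elem aff_K m) =
    (\<Sum>i\<in>UNIV. snd X $ Some i * of_int (m $ i)) *\<^sub>C JD_elem aff_K m"
  by (simp add: JD_bracket_def JD_elem_def laurent_ext_def aff_bracket_K[OF assms]
      J_deriv_0 J_deriv_single aff_deriv_K scaleC_single scaleC_prod_def[of _ "(_, _)"])

text \<open>Elements of h_(n-1) have no component along d_1, ..., d_(n-1), so the exponent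
  \<open>m\<close> does not enter \<open>D\<close>. This independence makes the later bounds uniform
  in \<open>m\<close>.\<close>

lemma h_sub_bracket:
  fixes h :: "('g::complex_vector, 'm::finite) JD"
  assumes "cbilinear br" "cbilinear form" "h \<in> h_sub H {None}"
  shows "\<exists>D. clinear D \<and> (\<forall>y m. JD_bracket br form h (JD_elem (aff_elem y a) m) =
    JD_elem (aff_elem (D y) a) m)"
proof -
  obtain x c \<delta> where h: "h = JD_elem (aff_elem x 0 + c *\<^sub>C aff_K) 0 + (0, \<delta>)"
    and \<delta>: "\<And>i. \<delta> $ Some i = 0"
    using assms(3) unfolding h_sub_def by auto
  let ?D = "\<lambda>y. br x y + (\<delta> $ None * of_int a) *\<^sub>C y"
  have "clinear (br x)" using assms(1) by (simp add: cbilinear_def)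
  then have "clinear ?D"
    by (intro clinearI) (simp_all add: clinear_add clinear_scale scaleC_add_right scaleC_scaleC
        algebra_simps)
  have bracket: "aff_bracket br form (aff_elem x 0 + c *\<^sub>C aff_K) (aff_elem y a) =
      aff_elem (br x y) a" for y
  proof -
    have "aff_bracket br form (aff_elem x 0 + c *\<^sub>C aff_K) (aff_elem y a) =
        aff_bracket br form (aff_elem x 0) (aff_elem y a)"
      by (simp add: aff_bracket_def aff_elem_def aff_K_def scaleC_prod_def)
    then show ?thesis by (simp add: aff_bracket_elem[OF assms(1,2)])
  qed
  have zero: "aff_bracket br form 0 v = 0" "aff_bracket br form v 0 = 0" for v
    using assms by (auto simp: aff_bracket_def laurent_ext_def cbilinear_0 prod_eq_iff)
  have deriv: "aff_deriv (aff_elem y a) = of_int a *\<^sub>C aff_elem y a" for y :: 'g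
    by (simp add: aff_deriv_def aff_elem_def mapp_single scaleC_single scaleC_prod_def)
  have "JD_bracket br form h (JD_elem (aff_elem y a) m) = JD_elem (aff_elem (?D y) a) m" for y m
  proof -
    have "JD_bracket br form h (JD_elem (aff_elem y a) m) =
        (Poly_Mapping.single m (aff_bracket br form (aff_elem x 0 + c *\<^sub>C aff_K) (aff_elem y a)) +
         J_deriv \<delta> (Poly_Mapping.single m (aff_elem y a)), 0)"
      by (simp add: h JD_bracket_def JD_elem_def laurent_ext_single zero J_deriv_0)
    also have "\<dots> = JD_elem (aff_elem (br x y) a + \<delta> $ None *\<^sub>C aff_deriv (aff_elem y a)) m"
      by (simp add: bracket J_deriv_single \<delta> JD_elem_def single_add)
    also have "aff_elem (br x y) a + \<delta> $ None *\<^sub>C aff_deriv (aff_elem y a) = aff_elem (?D y) a"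
      by (simp add: deriv aff_elem_add aff_elem_scale scaleC_scaleC)
    finally show ?thesis .
  qed
  with \<open>clinear ?D\<close> show ?thesis by blast
qed

text \<open>It lets a weight be determined by its values at finitely many torus elements.\<close>

lemma finite_dim_h_sub:
  assumes "finite_dim (UNIV :: 'g::complex_vector set)"
  shows "finite_dim (h_sub H {None} :: ('g, 'm::finite) JD set)"
proof -
  obtain B :: "'g set" where B: "finite B" "UNIV \<subseteq> cspan B"
    using assms finite_dim_def by blast
  let ?f = "\<lambda>x. JD_elem (aff_elem x 0) 0 :: ('g, 'm) JD"
  let ?C = "?f ` B \<union> {JD_elem aff_K 0, JD_d None}"
  have lin: "clinear ?f"
    by (rule clinearI) (simp_all add: aff_elem_add aff_elem_scale JD_elem_add JD_elem_scale)
  have f: "?f x \<in> cspan ?C" for x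
  proof -
    have "?f x \<in> ?f ` cspan B" using B(2) by (intro imageI) auto
    then show ?thesis
      unfolding span_image_clinear[OF lin, symmetric]
      by (rule subsetD[OF complex_vector.span_mono, rotated]) (rule Un_upper1)
  qed
  have "h \<in> cspan ?C" if h_sub: "h \<in> h_sub H {None}" for h
  proof -
    obtain x c \<delta> where h: "h = JD_elem (aff_elem x 0 + c *\<^sub>C aff_K) 0 + (0, \<delta>)"
      and \<delta>: "\<And>i. \<delta> $ Some i = 0"
      using h_sub unfolding h_sub_def by auto
    have "\<delta> $ i = 0" if "i \<noteq> None" for i
      using that \<delta> by (cases i) auto
    then have "(0, \<delta>) \<in> (JD_sub {None} :: ('g, 'm) JD set)" by (simp add: JD_sub_def)
    from JD_sub_None_deriv[OF this]
    have "h = ?f x + c *\<^sub>C JD_elem aff_K 0 + (\<delta> $ None) *\<^sub>C JD_d None"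
      unfolding h JD_elem_add JD_elem_scale by simp
    moreover have "JD_elem aff_K 0 \<in> cspan ?C" "JD_d None \<in> cspan ?C"
      by (rule complex_vector.span_base, simp)+
    ultimately show ?thesis
      using complex_vector.span_add complex_vector.span_scale f by metis
  qed
  then have "h_sub H {None} \<subseteq> cspan ?C" by (rule subsetI)
  then show ?thesis using B(1) unfolding finite_dim_def by (intro exI[of _ ?C] conjI) simp_all
qed

section \<open>Weight modules over \<open>J \<oplus> \<complex>d\<^sub>n\<close>\<close>

text \<open>\<open>act\<close> plays the role of the action on V_1; the module V enters only when
  the central operators are compared with it.\<close>

locale irreducible_weight_module =
  fixes br :: "'g::complex_vector \<Rightarrow> 'g \<Rightarrow> 'g"
    and form :: "'g \<Rightarrow> 'g \<Rightarrow> complex"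
    and H :: "'g set"
    and act :: "('g, 'm::finite) JD \<Rightarrow> 'w::complex_vector \<Rightarrow> 'w"
  assumes br: "cbilinear br" and form: "cbilinear form"
    and form_nonzero: "\<exists>x y. form x y \<noteq> 0"
    and finite_dim_g: "finite_dim (UNIV :: 'g set)"
    and irreducible: "irreducible_module (JD_bracket br form) (JD_sub {None}) act"
    and weight: "weight_module (h_sub H {None}) act"
    and finite_dim_weights: "finite_dim_weight_spaces (h_sub H {None}) act"
begin

abbreviation "T \<equiv> h_sub H {None} :: ('g, 'm) JD set"

abbreviation "E x a m \<equiv> JD_elem (aff_elem x a) m :: ('g, 'm) JD"

abbreviation "K m \<equiv> JD_elem aff_K m :: ('g, 'm) JD"

text \<open>The set consists of spaces rather than functionals, since functionals that agree on
  \<open>T\<close> give the same space. The zero space is a member as soon as some functional is not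
  a weight, hence the later conditions \<open>S \<noteq> {0}\<close>.\<close>

definition weights :: "'w set set" where
  "weights = {weight_space T act \<mu> | \<mu>. True}"

lemma act_linear: "X \<in> JD_sub {None} \<Longrightarrow> clinear (act X)"
  and act_add: "X \<in> JD_sub {None} \<Longrightarrow> Y \<in> JD_sub {None} \<Longrightarrow> act (X + Y) v = act X v + act Y v"
  and act_scale: "X \<in> JD_sub {None} \<Longrightarrow> act (c *\<^sub>C X) v = c *\<^sub>C act X v"
  and act_bracket: "X \<in> JD_sub {None} \<Longrightarrow> Y \<in> JD_sub {None} \<Longrightarrow>
    act (JD_bracket br form X Y) v = act X (act Y v) - act Y (act X v)"
  using irreducible unfolding irreducible_module_def lie_module_def by blast+

lemma act_elem_linear: "clinear (act (JD_elem X m))"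
  by (rule act_linear[OF JD_elem_in_JD_sub])

lemma act_d_linear: "clinear (act (JD_d None))"
  by (rule act_linear) (simp add: JD_d_in_JD_sub)

lemma act_0: "act 0 v = 0"
  using act_scale[of 0 0 v] by (simp add: JD_sub_def)

lemma act_elem_0: "act (JD_elem 0 m) v = 0"
proof -
  have "JD_elem 0 m = (0 :: ('g, 'm) JD)" by (simp add: JD_elem_def prod_eq_iff)
  then show ?thesis by (simp add: act_0)
qed

lemma subspace_L: "csubspace (JD_sub {None} :: ('g, 'm) JD set)"
  by (rule subspace_JD_sub)

lemma submodule_trivial: "submodule (JD_sub {None}) act S \<Longrightarrow> S = {0} \<or> S = UNIV"
  using irreducible by (auto simp: irreducible_module_def irreducible_submodule_def)

lemma UNIV_nontrivial: "(UNIV :: 'w set) \<noteq> {0}"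
  using irreducible by (auto simp: irreducible_module_def irreducible_submodule_def)

lemma act_decomposition:
  assumes "X \<in> JD_sub {None}"
  shows "act X v = (\<Sum>m\<in>Poly_Mapping.keys (fst X).
    act (JD_elem (poly_mapping.lookup (fst X) m) m) v) + (snd X $ None) *\<^sub>C act (JD_d None) v"
proof -
  have *: "sum f A \<in> JD_sub {None} \<and> act (sum f A) v = (\<Sum>a\<in>A. act (f a) v)"
    if "\<And>a. a \<in> A \<Longrightarrow> f a \<in> JD_sub {None}" "finite A" for A :: "(int ^ 'm) set" and f
    using that(2,1)
  proof (induction A rule: finite_induct)
    case empty
    then show ?case by (simp add: act_0 JD_sub_def)
  next
    case (insert a A)
    then show ?case
      by (auto simp: act_add complex_vector.subspace_add[OF subspace_L])
  qed
  let ?S = "\<Sum>m\<in>Poly_Mapping.keys (fst X). JD_elem (poly_mapping.lookup (fst X) m) m"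
  have d: "(JD_d None :: ('g, 'm) JD) \<in> JD_sub {None}" by (simp add: JD_d_in_JD_sub)
  have "?S \<in> JD_sub {None} \<and> act ?S v = (\<Sum>m\<in>Poly_Mapping.keys (fst X).
    act (JD_elem (poly_mapping.lookup (fst X) m) m) v)"
    by (intro *) (simp_all add: JD_elem_in_JD_sub)
  moreover have "act X v = act (?S + (snd X $ None) *\<^sub>C JD_d None) v"
    using JD_decomposition[of X] JD_sub_None_deriv[OF assms] by simp
  ultimately show ?thesis
    using d complex_vector.subspace_scale[OF subspace_L d] by (simp add: act_add act_scale)
qed

lemma submoduleI:
  assumes "csubspace S" "\<And>X m v. v \<in> S \<Longrightarrow> act (JD_elem X m) v \<in> S"
    and "\<And>v. v \<in> S \<Longrightarrow> act (JD_d None) v \<in> S"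
  shows "submodule (JD_sub {None}) act S"
  unfolding submodule_def
proof (intro conjI ballI)
  fix X :: "('g, 'm) JD" and v assume "X \<in> JD_sub {None}" "v \<in> S"
  then show "act X v \<in> S"
    by (simp add: act_decomposition assms complex_vector.subspace_add complex_vector.subspace_sum
        complex_vector.subspace_scale)
qed (rule assms(1))

lemma T_subset: "h \<in> T \<Longrightarrow> h \<in> JD_sub {None}"
  using h_sub_subset by blast

section \<open>Weight spaces and weight decompositions\<close>

lemma subspace_weight_space: "csubspace (weight_space T act \<mu>)"
  unfolding complex_vector.subspace_def weight_space_def
  by (auto simp: clinear_0 clinear_add clinear_scale act_linear T_subset
      scaleC_add_right scaleC_scaleC mult.commute)

lemma subspace_weights: "S \<in> weights \<Longrightarrow> csubspace S"
  unfolding weights_def using subspace_weight_space by blast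

lemma span_weights: "cspan (\<Union>weights) = UNIV"
  and independent_weights: "S \<in> weights \<Longrightarrow> S \<inter> cspan (\<Union>(weights - {S})) = {0}"
  using weight unfolding weight_module_def direct_sum_decomposition_def weights_def by blast+

lemma finite_dim_weight_sum: "finite M \<Longrightarrow> M \<subseteq> weights \<Longrightarrow> finite_dim (cspan (\<Union>M))"
  using finite_dim_weights unfolding finite_dim_weight_spaces_def weights_def
  by (intro finite_dim_Union) auto

definition weight_of :: "'w set \<Rightarrow> ('g, 'm) JD \<Rightarrow> complex" where
  "weight_of S = (SOME \<mu>. S = weight_space T act \<mu>)"

lemma weight_of: "S \<in> weights \<Longrightarrow> weight_space T act (weight_of S) = S"
  unfolding weight_of_def weights_def
  using someI_ex[of "\<lambda>\<mu>. S = weight_space T act \<mu>"] by auto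

lemma act_weight: "S \<in> weights \<Longrightarrow> v \<in> S \<Longrightarrow> h \<in> T \<Longrightarrow> act h v = weight_of S h *\<^sub>C v"
  using weight_of unfolding weight_space_def by blast

lemma weight_of_distinct:
  assumes "S \<in> weights" "S' \<in> weights" "S \<noteq> S'"
  shows "\<exists>h\<in>T. weight_of S h \<noteq> weight_of S' h"
proof (rule ccontr)
  assume "\<not> ?thesis"
  then have "weight_space T act (weight_of S) = weight_space T act (weight_of S')"
    by (auto simp: weight_space_def)
  then show False using assms weight_of by metis
qed

lemma weight_decomposition:
  "\<exists>M w. finite M \<and> M \<subseteq> weights \<and> (\<forall>S\<in>M. w S \<in> S) \<and> v = sum w M"
  using mem_span_Union_sum[of v weights] span_weights subspace_weights by blast

lemma weight_components:
  assumes "csubspace U" "\<And>h x. h \<in> T \<Longrightarrow> x \<in> U \<Longrightarrow> act h x \<in> U"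
    and "finite M" "M \<subseteq> weights" "\<And>S. S \<in> M \<Longrightarrow> w S \<in> S" "sum w M \<in> U" "S \<in> M"
  shows "w S \<in> U"
proof (rule stable_subspace_components[where T = act and B = T and e = weight_of and M = M and S = U])
  show "act h (w S) = weight_of S h *\<^sub>C w S" if "h \<in> T" "S \<in> M" for h S
    using act_weight assms that by blast
  show "\<exists>b\<in>T. weight_of i b \<noteq> weight_of j b" if "i \<in> M" "j \<in> M" "i \<noteq> j" for i j
    using weight_of_distinct assms(4) that by blast
qed (use assms act_linear T_subset in auto)

text \<open>By the Leibniz rule, applying \<open>h\<close> to \<open>act (E x a m) v\<close> amounts
  to applying \<open>D + \<mu> h\<close> to \<open>x\<close> in the finite dimensional g, where the
  iterates are related. The relation is the same for all \<open>m\<close> and \<open>v\<close>, and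
  it replaces a decomposition of \<open>x\<close> into root vectors.\<close>

lemma weight_polynomial:
  assumes h: "h \<in> T"
  shows "\<exists>N c. (\<exists>j\<le>N. c j \<noteq> 0) \<and> (\<forall>m. \<forall>v\<in>weight_space T act \<mu>.
    (\<Sum>j\<le>N. c j *\<^sub>C (act h ^^ j) (act (E x a m) v)) = 0)"
proof -
  obtain D where D: "clinear D"
    "\<And>y m. JD_bracket br form h (E y a m) = E (D y) a m"
    using h_sub_bracket[OF br form h, of a] by blast
  let ?D = "\<lambda>y. D y + \<mu> h *\<^sub>C y"
  obtain B :: "'g set" where B: "finite B" "UNIV \<subseteq> cspan B"
    using finite_dim_g finite_dim_def by blast
  then obtain N c where c: "\<exists>j\<le>N. c j \<noteq> 0" "(\<Sum>j\<le>N. c j *\<^sub>C (?D ^^ j) x) = 0"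
    using sequence_relation[OF B(1), of "\<lambda>j. (?D ^^ j) x"] by blast
  have "(\<Sum>j\<le>N. c j *\<^sub>C (act h ^^ j) (act (E x a m) v)) = 0"
    if v: "v \<in> weight_space T act \<mu>" for m v
  proof -
    have lin: "clinear (\<lambda>y. act (E y a m) v)"
      by (rule clinearI)
        (simp_all add: aff_elem_add aff_elem_scale JD_elem_add JD_elem_scale act_add act_scale
          JD_elem_in_JD_sub)
    have step: "act h (act (E y a m) v) = act (E (?D y) a m) v" for y
    proof -
      have "act h (act (E y a m) v) = act (E (D y) a m) v + act (E y a m) (act h v)"
        using act_bracket[OF T_subset[OF h] JD_elem_in_JD_sub, of "aff_elem y a" m v] D(2)
        by (simp add: algebra_simps)
      also have "act h v = \<mu> h *\<^sub>C v" using v h by (simp add: weight_space_def)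
      finally show ?thesis
        using clinear_add[OF lin] clinear_scale[OF lin]
        by (simp add: clinear_scale[OF act_elem_linear])
    qed
    have "(act h ^^ j) (act (E x a m) v) = act (E ((?D ^^ j) x) a m) v" for j
      by (induction j) (simp_all add: step)
    then have "(\<Sum>j\<le>N. c j *\<^sub>C (act h ^^ j) (act (E x a m) v)) =
        act (E (\<Sum>j\<le>N. c j *\<^sub>C (?D ^^ j) x) a m) v"
      by (simp add: clinear_sum[OF lin] clinear_scale[OF lin])
    also have "\<dots> = 0" unfolding c(2) by (rule clinear_0[OF lin])
    finally show ?thesis .
  qed
  with c(1) show ?thesis by blast
qed

text \<open>\<open>weight_of\<close> is an arbitrary choice, and only a non-zero weight vector
  forces its values to be compatible with linear combinations: the elements that act on
  \<open>w\<close> and \<open>w'\<close> by one common scalar form a subspace, which contains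
  \<open>C\<close> and hence \<open>T\<close>.\<close>

lemma weight_eqI:
  assumes "S \<in> weights" "S' \<in> weights" "S \<noteq> {0}" "S' \<noteq> {0}"
    and C: "C \<subseteq> T" "T \<subseteq> cspan C" and eq: "\<And>h. h \<in> C \<Longrightarrow> weight_of S h = weight_of S' h"
  shows "S = S'"
proof (rule ccontr)
  assume "S \<noteq> S'"
  obtain w w' where w: "w \<in> S" "w \<noteq> 0" "w' \<in> S'" "w' \<noteq> 0"
    using assms(1-4) subspace_weights complex_vector.subspace_0 by blast
  let ?X = "{h \<in> JD_sub {None}. \<exists>c. act h w = c *\<^sub>C w \<and> act h w' = c *\<^sub>C w'}"
  have "csubspace ?X"
    unfolding complex_vector.subspace_def
  proof (intro conjI ballI allI)
    show "0 \<in> ?X" by (auto simp: act_0 JD_sub_def intro: exI[of _ 0])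
    fix x y assume x: "x \<in> ?X" and y: "y \<in> ?X"
    then show "x + y \<in> ?X"
      by (auto simp: act_add complex_vector.subspace_add[OF subspace_L]) (metis scaleC_add_left)
  next
    fix c x assume x: "x \<in> ?X"
    then show "c *\<^sub>C x \<in> ?X"
      by (auto simp: act_scale complex_vector.subspace_scale[OF subspace_L] scaleC_scaleC)
  qed
  moreover have "C \<subseteq> ?X"
  proof
    fix h assume h: "h \<in> C"
    then have hT: "h \<in> T" using C(1) by blast
    then show "h \<in> ?X"
      using act_weight[OF assms(1) w(1) hT] act_weight[OF assms(2) w(3) hT] eq[OF h] T_subset
      by auto
  qed
  ultimately have TX: "T \<subseteq> ?X" using C(2) complex_vector.span_minimal by blast
  have "weight_of S h = weight_of S' h" if h: "h \<in> T" for h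
  proof -
    obtain c where c: "act h w = c *\<^sub>C w" "act h w' = c *\<^sub>C w'" using TX h by blast
    have "weight_of S h = c"
      using act_weight[OF assms(1) w(1) h] c(1) w(2) by simp
    moreover have "weight_of S' h = c"
      using act_weight[OF assms(2) w(3) h] c(2) w(4) by simp
    ultimately show ?thesis by simp
  qed
  with weight_of_distinct[OF assms(1,2) \<open>S \<noteq> S'\<close>] show False by blast
qed

text \<open>\<open>R\<close> is the root set of the polynomial from
  \<open>weight_polynomial\<close>. It depends on \<open>S0\<close>, \<open>h\<close>,
  \<open>x\<close> and \<open>a\<close>, but not on \<open>m\<close> or \<open>v\<close>.\<close>

lemma finitely_many_eigenvalues:
  assumes S0: "S0 \<in> weights" and h: "h \<in> T"
  shows "\<exists>R. finite R \<and> (\<forall>m v Q w S. v \<in> S0 \<longrightarrow> finite Q \<longrightarrow> Q \<subseteq> weights \<longrightarrow>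
    (\<forall>S\<in>Q. w S \<in> S) \<longrightarrow> act (E x a m) v = sum w Q \<longrightarrow> S \<in> Q \<longrightarrow> w S \<noteq> 0 \<longrightarrow>
    weight_of S h \<in> R)"
proof -
  obtain N c where c: "\<exists>j\<le>N. c j \<noteq> 0"
    "\<And>m v. v \<in> S0 \<Longrightarrow> (\<Sum>j\<le>N. c j *\<^sub>C (act h ^^ j) (act (E x a m) v)) = 0"
    using weight_polynomial[OF h, where \<mu> = "weight_of S0" and x = x and a = a]
    unfolding weight_of[OF S0] by blast
  let ?R = "{z. (\<Sum>j\<le>N. c j * z ^ j) = 0}"
  show ?thesis
  proof (intro exI[of _ ?R] conjI allI impI)
    show "finite ?R" using c(1) by (metis polyfun_roots_finite)
    fix m v Q w S
    assume v: "v \<in> S0" and Q: "finite Q" "Q \<subseteq> weights" "\<forall>S\<in>Q. w S \<in> S"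
      and sum: "act (E x a m) v = sum w Q" and S: "S \<in> Q" "w S \<noteq> 0"
    have lin: "clinear (act h)" by (rule act_linear[OF T_subset[OF h]])
    have eig: "act h (w S) = weight_of S h *\<^sub>C w S" if "S \<in> Q" for S
      using Q that h act_weight by blast
    have pow: "(act h ^^ j) (w S) = weight_of S h ^ j *\<^sub>C w S" if "S \<in> Q" for S j
      by (induction j)
        (simp_all add: scaleC_one clinear_scale[OF lin] eig[OF that] scaleC_scaleC mult.commute)
    have pow_sum: "(act h ^^ j) (sum w Q) = (\<Sum>S\<in>Q. (act h ^^ j) (w S))" for j
      by (rule clinear_sum[OF clinear_funpow[OF lin]])
    let ?p = "\<lambda>S. \<Sum>j\<le>N. c j * weight_of S h ^ j"
    have "(\<Sum>S\<in>Q. ?p S *\<^sub>C w S) = (\<Sum>j\<le>N. \<Sum>S\<in>Q. (c j * weight_of S h ^ j) *\<^sub>C w S)"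
      by (subst sum.swap) (simp add: complex_vector.scale_sum_left)
    also have "\<dots> = (\<Sum>j\<le>N. c j *\<^sub>C (act h ^^ j) (sum w Q))"
      unfolding pow_sum
      by (intro sum.cong refl) (simp add: pow complex_vector.scale_sum_right scaleC_scaleC)
    also have "\<dots> = 0" using c(2)[OF v, of m] by (simp add: sum)
    finally have zero: "(\<Sum>S\<in>Q. ?p S *\<^sub>C w S) \<in> {0}" by simp
    have mem: "?p S *\<^sub>C w S \<in> S" if "S \<in> Q" for S
      using Q(2,3) that by (intro complex_vector.subspace_scale subspace_weights) auto
    have stable: "act h x \<in> {0}" if "h \<in> T" "x \<in> {0}" for h x
      using that clinear_0[OF act_linear[OF T_subset]] by simp
    \<comment> \<open>With the zero subspace as \<open>U\<close>, \<open>weight_components\<close>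
      says that a vanishing sum of weight vectors has vanishing terms.\<close>
    have "?p S *\<^sub>C w S \<in> {0}"
      by (rule weight_components[OF complex_vector.subspace_single_0 stable Q(1,2) mem zero S(1)])
    with S(2) show "weight_of S h \<in> ?R" by simp
  qed
qed

text \<open>A non-zero weight space is determined by the values of its weight on the finite set
  \<open>C\<close>, and each value is confined to the finite set \<open>R h\<close>. As
  \<open>R h\<close> does not depend on \<open>m\<close>, one \<open>M\<close> serves all
  exponents.\<close>

lemma act_weight_space_finite:
  assumes "S0 \<in> weights"
  shows "\<exists>M. finite M \<and> M \<subseteq> weights \<and> (\<forall>m. \<forall>v\<in>S0. act (E x a m) v \<in> cspan (\<Union>M))"
proof -
  obtain C where C: "finite C" "C \<subseteq> T" "T \<subseteq> cspan C"
    by (rule finite_dim_finite_spanning[OF finite_dim_h_sub[OF finite_dim_g]])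
  let ?P = "\<lambda>h R. finite R \<and> (\<forall>m v Q w S. v \<in> S0 \<longrightarrow> finite Q \<longrightarrow>
      Q \<subseteq> weights \<longrightarrow> (\<forall>S\<in>Q. w S \<in> S) \<longrightarrow> act (E x a m) v = sum w Q \<longrightarrow> S \<in> Q \<longrightarrow>
      w S \<noteq> 0 \<longrightarrow> weight_of S h \<in> R)"
  have "\<forall>h\<in>T. \<exists>R. ?P h R" by (intro ballI finitely_many_eigenvalues assms)
  from bchoice[OF this] obtain R where R: "\<forall>h\<in>T. ?P h (R h)" by (elim exE)
  have "finite (R h)" if "h \<in> C" for h using that C(2) R by auto
  then have finite_R: "finite (PiE C R)" by (rule finite_PiE[OF C(1)])
  let ?M = "{S \<in> weights. S \<noteq> {0} \<and> (\<forall>h\<in>C. weight_of S h \<in> R h)}"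
  have "inj_on (\<lambda>S. restrict (weight_of S) C) ?M"
  proof (rule inj_onI)
    fix S S' assume S: "S \<in> ?M" "S' \<in> ?M"
      and eq: "restrict (weight_of S) C = restrict (weight_of S') C"
    have "weight_of S h = weight_of S' h" if "h \<in> C" for h
      using fun_cong[OF eq, of h] that by simp
    then show "S = S'" using S by (intro weight_eqI[OF _ _ _ _ C(2,3)]) simp_all
  qed
  moreover have "(\<lambda>S. restrict (weight_of S) C) ` ?M \<subseteq> PiE C R" by auto
  ultimately have "finite ?M" using finite_R finite_imageD finite_subset by blast
  moreover have "act (E x a m) v \<in> cspan (\<Union>?M)" if v: "v \<in> S0" for m v
  proof -
    obtain Q w where Q: "finite Q" "Q \<subseteq> weights" "\<forall>S\<in>Q. w S \<in> S"
      and sum: "act (E x a m) v = sum w Q"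
      using weight_decomposition[of "act (E x a m) v"] by blast
    have "w S \<in> cspan (\<Union>?M)" if S: "S \<in> Q" for S
    proof (cases "w S = 0")
      case True
      then show ?thesis by (simp add: complex_vector.span_zero)
    next
      case False
      have "weight_of S h \<in> R h" if "h \<in> C" for h
        using bspec[OF R, of h, THEN conjunct2, rule_format, OF _ v Q(1,2) _ sum S False] Q(3)
          that C(2) by auto
      then have "S \<in> ?M" using S Q False by auto
      then have "w S \<in> \<Union>?M" using Q(3) S by blast
      then show ?thesis by (rule complex_vector.span_base)
    qed
    then show ?thesis unfolding sum by (rule complex_vector.span_sum)
  qed
  ultimately show ?thesis by (intro exI[of _ ?M] conjI) auto
qed

lemma act_weight_sum_finite:
  assumes "finite M" "M \<subseteq> weights"
  shows "\<exists>M'. finite M' \<and> M' \<subseteq> weights \<and>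
    (\<forall>m. \<forall>v\<in>cspan (\<Union>M). act (E x a m) v \<in> cspan (\<Union>M'))"
proof -
  let ?P = "\<lambda>S M'. finite M' \<and> M' \<subseteq> weights \<and> (\<forall>m. \<forall>v\<in>S. act (E x a m) v \<in> cspan (\<Union>M'))"
  have "\<forall>S\<in>M. \<exists>M'. ?P S M'" using assms(2) act_weight_space_finite by (meson subsetD)
  from bchoice[OF this] obtain F where F: "\<forall>S\<in>M. ?P S (F S)" by (elim exE)
  let ?M' = "\<Union>S\<in>M. F S"
  have "act (E x a m) v \<in> cspan (\<Union>?M')" if v: "v \<in> cspan (\<Union>M)" for m v
  proof -
    have "act (E x a m) u \<in> cspan (\<Union>?M')" if "S \<in> M" "u \<in> S" for S u
    proof (rule subsetD[OF complex_vector.span_mono])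
      show "act (E x a m) u \<in> cspan (\<Union>(F S))" using F that by simp
      show "\<Union>(F S) \<subseteq> \<Union>?M'" using that(1) by blast
    qed
    then have "\<Union>M \<subseteq> {u. act (E x a m) u \<in> cspan (\<Union>?M')}" by auto
    then have "cspan (\<Union>M) \<subseteq> {u. act (E x a m) u \<in> cspan (\<Union>?M')}"
      by (rule complex_vector.span_minimal)
        (rule subspace_vimage[OF act_elem_linear complex_vector.subspace_span])
    then show ?thesis using v by blast
  qed
  moreover have "finite ?M'" "?M' \<subseteq> weights" using F assms(1) by auto
  ultimately show ?thesis by (intro exI[of _ ?M'] conjI) simp_all
qed

lemma nonzero_weight: obtains S v where "S \<in> weights" "v \<in> S" "v \<noteq> 0"
proof (rule ccontr)
  assume "\<not> thesis"
  then have "\<Union>weights \<subseteq> {0}" using that by blast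
  then have "cspan (\<Union>weights) \<subseteq> {0}"
    by (intro complex_vector.span_minimal complex_vector.subspace_single_0)
  then show False using span_weights UNIV_nontrivial by blast
qed

section \<open>The central charges\<close>

lemma K_commutes:
  assumes "X \<in> JD_sub {None}"
  shows "act X (act (K m) v) = act (K m) (act X v)"
proof -
  have "JD_bracket br form X (K m) = 0"
    using assms JD_bracket_K[OF form, of br X m] by (simp add: JD_sub_def)
  then show ?thesis using act_bracket[OF assms JD_elem_in_JD_sub, of aff_K m v] act_0 by simp
qed

text \<open>Schur's lemma. V_1 may be infinite dimensional, so the eigenvector is sought in a weight
  space, which K_n(m) preserves because it commutes with the torus; the whole eigenspace is then a
  non-zero submodule.\<close>

lemma K_scalar_exists: "\<exists>c. \<forall>v. act (K m) v = c *\<^sub>C v"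
proof -
  obtain S v where S: "S \<in> weights" "v \<in> S" "v \<noteq> 0" by (rule nonzero_weight)
  have "finite_dim S"
    using finite_dim_subset[OF finite_dim_weight_sum[of "{S}"]] S complex_vector.span_superset
    by auto
  moreover have "act (K m) w \<in> S" if w: "w \<in> S" for w
  proof -
    have "act h (act (K m) w) = weight_of S h *\<^sub>C act (K m) w" if "h \<in> T" for h
      by (simp add: K_commutes T_subset that act_weight[OF S(1) w] clinear_scale[OF act_elem_linear])
    then have "act (K m) w \<in> weight_space T act (weight_of S)" by (simp add: weight_space_def)
    then show ?thesis by (simp only: weight_of[OF S(1)])
  qed
  ultimately obtain c w where w: "w \<in> S" "w \<noteq> 0" "act (K m) w = c *\<^sub>C w"
    using finite_dim_eigenvector[OF act_elem_linear subspace_weights[OF S(1)]] S by blast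
  let ?U = "{u. act (K m) u = c *\<^sub>C u}"
  have "clinear (\<lambda>u. act (K m) u - c *\<^sub>C u)"
    by (rule clinearI) (simp_all add: clinear_add clinear_scale act_elem_linear scaleC_add_right
        complex_vector.scale_right_diff_distrib scaleC_scaleC mult.commute)
  from subspace_kernel[OF this] have "csubspace ?U" by simp
  then have "submodule (JD_sub {None}) act ?U"
    unfolding submodule_def
    by (auto simp: K_commutes[symmetric] clinear_scale[OF act_linear])
  then have "?U = UNIV" using submodule_trivial w by force
  then show ?thesis by auto
qed

definition charge :: "int ^ 'm \<Rightarrow> complex" where
  "charge m = (SOME c. \<forall>v. act (K m) v = c *\<^sub>C v)"

lemma act_K: "act (K m) v = charge m *\<^sub>C v"
  using someI_ex[OF K_scalar_exists] unfolding charge_def by blast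

text \<open>The coefficients are fixed before \<open>s\<close>: the combination vanishes on all of
  \<open>cspan (\<Union>M1)\<close>, and this space contains the images of \<open>v\<close> under
  \<open>E y (- b) s\<close> for every \<open>s\<close>.\<close>

lemma charge_recurrence:
  "\<exists>N a. (\<exists>j\<le>N. a j \<noteq> 0) \<and> (\<forall>s. (\<Sum>j\<le>N. a j * charge (int j *s m + s)) = 0)"
proof -
  obtain x y where xy: "form x y \<noteq> 0" using form_nonzero by blast
  obtain S v where v: "S \<in> weights" "v \<in> S" "v \<noteq> 0" by (rule nonzero_weight)
  define I where "I = {0, 1 :: int}"
  let ?P = "\<lambda>b M. finite M \<and> M \<subseteq> weights \<and> (\<forall>m. \<forall>u\<in>S. act (E y (- b) m) u \<in> cspan (\<Union>M))"
  have "\<forall>b. \<exists>M. ?P b M" by (intro allI act_weight_space_finite v(1))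
  from choice[OF this] obtain M where M: "\<forall>b. ?P b (M b)" by (elim exE)
  \<comment> \<open>The commutator applies the two elements to \<open>v\<close> in both orders, so
    the combination has to annihilate \<open>v\<close> itself as well as its images under
    \<open>E y (- b) s\<close>.\<close>
  define M1 where "M1 = insert S (\<Union>b\<in>I. M b)"
  have M1: "finite M1" "M1 \<subseteq> weights" using M v(1) by (auto simp: M1_def I_def)
  have Y: "act (E y (- b) s) v \<in> cspan (\<Union>M1)" if "b \<in> I" for b s
  proof (rule subsetD[OF complex_vector.span_mono])
    show "act (E y (- b) s) v \<in> cspan (\<Union>(M b))" using M v(2) by simp
    show "\<Union>(M b) \<subseteq> \<Union>M1" using that by (auto simp: M1_def)
  qed
  have v1: "v \<in> cspan (\<Union>M1)" using v(2) by (auto simp: M1_def intro: complex_vector.span_base)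
  obtain B where B: "finite B" "B \<subseteq> cspan (\<Union>M1)" "cspan (\<Union>M1) \<subseteq> cspan B"
    by (rule finite_dim_finite_spanning[OF finite_dim_weight_sum[OF M1]])
  let ?Q = "\<lambda>b M'. finite M' \<and> M' \<subseteq> weights \<and>
      (\<forall>m. \<forall>u\<in>cspan (\<Union>M1). act (E x b m) u \<in> cspan (\<Union>M'))"
  have "\<forall>b. \<exists>M'. ?Q b M'" by (intro allI act_weight_sum_finite M1)
  from choice[OF this] obtain F where F: "\<forall>b. ?Q b (F b)" by (elim exE)
  define M2 where "M2 = (\<Union>b\<in>I. F b)"
  have M2: "finite M2" "M2 \<subseteq> weights" using F by (auto simp: M2_def I_def)
  have X: "act (E x b r) u \<in> cspan (\<Union>M2)" if "b \<in> I" "u \<in> cspan (\<Union>M1)" for b r u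
  proof (rule subsetD[OF complex_vector.span_mono])
    show "act (E x b r) u \<in> cspan (\<Union>(F b))" using F that(2) by simp
    show "\<Union>(F b) \<subseteq> \<Union>M2" using that(1) by (auto simp: M2_def)
  qed
  obtain B2 where B2: "finite B2" "cspan (\<Union>M2) \<subseteq> cspan B2"
    using finite_dim_weight_sum[OF M2] finite_dim_def by blast
  have "\<exists>N a. (\<exists>j\<le>N. a j \<noteq> 0) \<and>
      (\<forall>i\<in>I \<times> B. (\<Sum>j\<le>N. a j *\<^sub>C act (E x (fst i) (int j *s m)) (snd i)) = 0)"
  proof (rule sequences_relation[of "I \<times> B" B2])
    show "finite (I \<times> B)" using B(1) by (simp add: I_def)
    fix i j assume "i \<in> I \<times> B"
    then have "act (E x (fst i) (int j *s m)) (snd i) \<in> cspan (\<Union>M2)"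
      using B(2) by (intro X) auto
    then show "act (E x (fst i) (int j *s m)) (snd i) \<in> cspan B2" using B2(2) by blast
  qed (rule B2(1))
  then obtain N a where "(\<exists>j\<le>N. a j \<noteq> 0) \<and>
      (\<forall>i\<in>I \<times> B. (\<Sum>j\<le>N. a j *\<^sub>C act (E x (fst i) (int j *s m)) (snd i)) = 0)"
    by (elim exE)
  note a = conjunct1[OF this] conjunct2[OF this]
  let ?P = "\<lambda>b u. \<Sum>j\<le>N. a j *\<^sub>C act (E x b (int j *s m)) u"
  have P: "?P b u = 0" if "b \<in> I" "u \<in> cspan (\<Union>M1)" for b u
  proof -
    have "clinear (?P b)"
      by (rule clinearI) (simp_all add: clinear_add clinear_scale act_elem_linear scaleC_add_right
          sum.distrib complex_vector.scale_sum_right scaleC_scaleC mult.commute)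
    then have "cspan B \<subseteq> {u. ?P b u = 0}"
      using a(2) that(1) by (intro complex_vector.span_minimal subspace_kernel) auto
    then show ?thesis using B(3) that(2) by blast
  qed
  have bracket: "(\<Sum>j\<le>N. a j *\<^sub>C act (E (br x y) 0 (int j *s m + s)) v) +
      (of_int b * form x y * (\<Sum>j\<le>N. a j * charge (int j *s m + s))) *\<^sub>C v = 0"
    if b: "b \<in> I" for b s
  proof -
    let ?Y = "act (E y (- b) s)"
    have "act (E x b r) (?Y v) - ?Y (act (E x b r) v) =
        act (E (br x y) 0 (r + s)) v + (of_int b * form x y * charge (r + s)) *\<^sub>C v" for r
    proof -
      have "JD_bracket br form (E x b r) (E y (- b) s) =
          E (br x y) 0 (r + s) + (of_int b * form x y) *\<^sub>C K (r + s)"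
        by (simp add: JD_bracket_elem[OF br form] aff_bracket_elem[OF br form] JD_elem_add
            JD_elem_scale)
      then show ?thesis
        using act_bracket[OF JD_elem_in_JD_sub JD_elem_in_JD_sub, of "aff_elem x b" r
            "aff_elem y (- b)" s v]
        by (simp add: act_add act_scale act_K scaleC_scaleC JD_elem_in_JD_sub
            complex_vector.subspace_scale[OF subspace_L])
    qed
    then have "(\<Sum>j\<le>N. a j *\<^sub>C act (E (br x y) 0 (int j *s m + s)) v) +
        (\<Sum>j\<le>N. a j *\<^sub>C (of_int b * form x y * charge (int j *s m + s)) *\<^sub>C v) =
        (\<Sum>j\<le>N. a j *\<^sub>C (act (E x b (int j *s m)) (?Y v) - ?Y (act (E x b (int j *s m)) v)))"
      by (simp only: sum.distrib[symmetric] scaleC_add_right)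
    also have "\<dots> = ?P b (?Y v) - ?Y (?P b v)"
      by (simp only: complex_vector.scale_right_diff_distrib sum_subtractf
          clinear_sum[OF act_elem_linear] clinear_scale[OF act_elem_linear])
    also have "\<dots> = 0"
      using P[OF b Y[OF b]] P[OF b v1] clinear_0[OF act_elem_linear] by simp
    also have "(\<Sum>j\<le>N. a j *\<^sub>C (of_int b * form x y * charge (int j *s m + s)) *\<^sub>C v) =
        (of_int b * form x y * (\<Sum>j\<le>N. a j * charge (int j *s m + s))) *\<^sub>C v"
      by (simp add: scaleC_scaleC complex_vector.scale_sum_left[symmetric] sum_distrib_left
          algebra_simps)
    finally show ?thesis .
  qed
  \<comment> \<open>For \<open>b = 0\<close> the multiple of \<open>v\<close> is absent, so the sum
    with \<open>br x y\<close> vanishes. The same sum occurs for \<open>b = 1\<close>, where only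
    the multiple of \<open>v\<close> then remains.\<close>
  have "(\<Sum>j\<le>N. a j * charge (int j *s m + s)) = 0" for s
    using bracket[of 0 s] bracket[of 1 s] xy v(3) by (simp add: I_def)
  with a(1) show ?thesis by blast
qed

text \<open>The leading term of the recurrence determines \<open>charge (i *s m)\<close> from the values at smaller
  multiples, so the charge cannot vanish at all negative multiples of \<open>m\<close>.\<close>

lemma charge_negative_multiple:
  assumes "charge m \<noteq> 0"
  shows "\<exists>i::nat. charge (- int (Suc i) *s m) \<noteq> 0"
proof (rule ccontr)
  assume "\<not> ?thesis"
  then have neg: "charge (- int (Suc i) *s m) = 0" for i by blast
  obtain N a where a: "\<exists>j\<le>N. a j \<noteq> 0"
    and rec: "\<And>s. (\<Sum>j\<le>N. a j * charge (int j *s m + s)) = 0"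
    using charge_recurrence[of m] by blast
  define d where "d = Max {j. j \<le> N \<and> a j \<noteq> 0}"
  have fin: "finite {j. j \<le> N \<and> a j \<noteq> 0}" by simp
  have d: "d \<le> N" "a d \<noteq> 0" using Max_in[OF fin] a unfolding d_def by auto
  have above: "a j = 0" if "d < j" "j \<le> N" for j
  proof (rule ccontr)
    assume "a j \<noteq> 0"
    then have "j \<le> d" unfolding d_def using fin that(2) by (intro Max_ge) simp_all
    with that(1) show False by simp
  qed
  \<comment> \<open>Here \<open>n\<close> bounds the multiples from above only; the base case
    consists of all negative multiples, however far down the recurrence reaches.\<close>
  have "charge (i *s m) = 0" if "i < int n" for i n
    using that
  proof (induction n arbitrary: i)
    case 0
    then show ?case using neg[of "nat (- i) - 1"] by simp
  next
    case (Suc n)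
    \<comment> \<open>With \<open>s = (i - d) m\<close> the term of index \<open>d\<close> sits at
      \<open>i m\<close>, while smaller indices hit multiples below \<open>i\<close>.\<close>
    have vanish: "a j * charge (int j *s m + (i - int d) *s m) = 0" if j: "j \<noteq> d" "j \<le> N" for j
    proof (cases "j < d")
      case True
      have "int j *s m + (i - int d) *s m = (i - int (d - j)) *s m"
        using True by (simp add: vec_eq_iff algebra_simps of_nat_diff)
      moreover have "charge ((i - int (d - j)) *s m) = 0" using True Suc.prems by (intro Suc.IH) simp
      ultimately show ?thesis by (simp only: mult_zero_right)
    next
      case False
      then show ?thesis using above[of j] j by simp
    qed
    have "(\<Sum>j\<le>N. a j * charge (int j *s m + (i - int d) *s m)) =
        a d * charge (int d *s m + (i - int d) *s m) +
        (\<Sum>j\<in>{..N} - {d}. a j * charge (int j *s m + (i - int d) *s m))"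
      using d(1) by (intro sum.remove) simp_all
    moreover have "(\<Sum>j\<in>{..N} - {d}. a j * charge (int j *s m + (i - int d) *s m)) = 0"
      by (intro sum.neutral ballI vanish) auto
    moreover have "int d *s m + (i - int d) *s m = i *s m"
      by (simp add: vec_eq_iff algebra_simps)
    ultimately show ?case using rec[of "(i - int d) *s m"] d(2) by (simp only:) simp
  qed
  from this[of 1 2] assms show False by simp
qed

end

section \<open>Semisimplicity\<close>

lemma submodule_span:
  assumes lin: "\<And>X. X \<in> L \<Longrightarrow> clinear (act X)"
    and gen: "\<And>X v. X \<in> L \<Longrightarrow> v \<in> G \<Longrightarrow> act X v \<in> cspan G"
  shows "submodule L act (cspan G)"
  unfolding submodule_def
proof (intro conjI ballI complex_vector.subspace_span)
  fix X v assume X: "X \<in> L" and v: "v \<in> cspan G"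
  have "G \<subseteq> {v. act X v \<in> cspan G}" using gen[OF X] by blast
  then have "cspan G \<subseteq> {v. act X v \<in> cspan G}"
    by (rule complex_vector.span_minimal)
      (rule subspace_vimage[OF lin[OF X] complex_vector.subspace_span])
  then show "act X v \<in> cspan G" using v by blast
qed

lemma submodule_inter: "submodule L act S \<Longrightarrow> submodule L act R \<Longrightarrow> submodule L act (S \<inter> R)"
  by (simp add: submodule_def complex_vector.subspace_inter)

lemma submodule_Inter: "(\<And>S. S \<in> \<S> \<Longrightarrow> submodule L act S) \<Longrightarrow> submodule L act (\<Inter>\<S>)"
  by (auto simp: submodule_def intro: complex_vector.subspace_Inter)

text \<open>A minimal subfamily that still spans is automatically direct: an irreducible member that
  meets the span of the others non-trivially is contained in it and could be omitted.\<close>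

lemma completely_reducible_finite_sum:
  assumes lin: "\<And>X. X \<in> L \<Longrightarrow> clinear (act X)"
    and fin: "finite \<S>" and irr: "\<And>S. S \<in> \<S> \<Longrightarrow> irreducible_submodule L act S"
    and span: "cspan (\<Union>\<S>) = UNIV"
  shows "completely_reducible L act"
proof -
  let ?F = "{\<R>. \<R> \<subseteq> \<S> \<and> cspan (\<Union>\<R>) = UNIV}"
  have "finite ?F" using fin by simp
  moreover have "?F \<noteq> {}" using span by blast
  ultimately obtain \<R> where \<R>: "\<R> \<in> ?F" and min: "\<And>\<Q>. \<Q> \<in> ?F \<Longrightarrow> \<Q> \<subseteq> \<R> \<Longrightarrow> \<R> = \<Q>"
    using finite_has_minimal[of ?F] by meson
  have irr': "irreducible_submodule L act S" if "S \<in> \<R>" for S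
    using that \<R> irr by blast
  then have sub: "submodule L act S" if "S \<in> \<R>" for S
    using that by (simp add: irreducible_submodule_def)
  have "S \<inter> cspan (\<Union>(\<R> - {S})) = {0}" if S: "S \<in> \<R>" for S
  proof (rule ccontr)
    let ?C = "cspan (\<Union>(\<R> - {S}))"
    assume ne: "S \<inter> ?C \<noteq> {0}"
    have "submodule L act ?C"
    proof (rule submodule_span[OF lin])
      fix X v assume "X \<in> L" "v \<in> \<Union>(\<R> - {S})"
      then have "act X v \<in> \<Union>(\<R> - {S})" using sub by (auto simp: submodule_def)
      then show "act X v \<in> ?C" by (rule complex_vector.span_base)
    qed
    then have "submodule L act (S \<inter> ?C)" using submodule_inter sub[OF S] by blast
    then have SC: "S \<inter> ?C = S"
      using irr'[OF S] ne unfolding irreducible_submodule_def by blast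
    have "\<Union>\<R> \<subseteq> ?C"
    proof
      fix v assume "v \<in> \<Union>\<R>"
      then have "v \<in> S \<or> v \<in> \<Union>(\<R> - {S})" by blast
      then show "v \<in> ?C"
      proof
        assume "v \<in> S"
        then have "v \<in> S \<inter> ?C" using SC by simp
        then show ?thesis by (rule IntD2)
      qed (rule complex_vector.span_base)
    qed
    then have "cspan (\<Union>\<R>) \<subseteq> ?C"
      by (rule complex_vector.span_minimal) (rule complex_vector.subspace_span)
    then have "?C = UNIV" using \<R> by auto
    then have "\<R> = \<R> - {S}" using \<R> by (intro min) auto
    with S show False by blast
  qed
  moreover have "csubspace S" if "S \<in> \<R>" for S using sub[OF that] by (simp add: submodule_def)
  ultimately have "direct_sum_decomposition \<R>"
    using \<R> by (auto simp: direct_sum_decomposition_def)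
  with irr' show ?thesis unfolding completely_reducible_def by blast
qed

text \<open>A proper subspace has smaller dimension, so a member of least dimension is minimal, even
  though \<open>\<F>\<close> may be infinite.\<close>

lemma finite_dim_minimal_subspace:
  assumes "finite_dim E" "\<F> \<noteq> {}" and sub: "\<And>U. U \<in> \<F> \<Longrightarrow> csubspace U \<and> U \<subseteq> E"
  shows "\<exists>U\<in>\<F>. \<forall>U'\<in>\<F>. U' \<subseteq> U \<longrightarrow> U' = U"
proof -
  obtain B where B: "finite B" "E \<subseteq> cspan B" using assms(1) finite_dim_def by blast
  obtain U where U: "U \<in> \<F>" and min: "\<And>U'. U' \<in> \<F> \<Longrightarrow> complex_vector.dim U \<le> complex_vector.dim U'"
    using ex_has_least_nat[of "\<lambda>U. U \<in> \<F>" _ complex_vector.dim] assms(2) by blast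
  have "U' = U" if U': "U' \<in> \<F>" "U' \<subseteq> U" for U'
  proof (rule ccontr)
    assume "U' \<noteq> U"
    then obtain x where x: "x \<in> U" "x \<notin> U'" using U' by blast
    obtain C where C: "C \<subseteq> U" "\<not> complex_vector.dependent C" "U \<subseteq> cspan C"
      "card C = complex_vector.dim U"
      by (rule complex_vector.basis_exists)
    obtain C' where C': "C' \<subseteq> U'" "\<not> complex_vector.dependent C'" "U' \<subseteq> cspan C'"
      "card C' = complex_vector.dim U'"
      by (rule complex_vector.basis_exists)
    have "C \<subseteq> cspan B" using C(1) sub[OF U] B(2) by (meson order_trans)
    note fin = conjunct1[OF complex_vector.independent_span_bound[OF B(1) C(2) this]]
    have "cspan C' \<subseteq> U'"
      by (rule complex_vector.span_minimal[OF C'(1)]) (simp add: sub[OF U'(1)])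
    then have xC': "x \<notin> cspan C'" using x(2) by auto
    have indep: "\<not> complex_vector.dependent (insert x C')"
      by (rule complex_vector.independent_insertI[OF xC' C'(2)])
    have "insert x C' \<subseteq> U" using x(1) C'(1) U'(2) by auto
    then have "insert x C' \<subseteq> cspan C" using C(3) by (rule order_trans)
    then have ins: "finite (insert x C') \<and> card (insert x C') \<le> card C"
      by (rule complex_vector.independent_span_bound[OF fin indep])
    have "x \<notin> C'" using xC' complex_vector.span_superset[of C'] by auto
    then have "card C' < card C" using conjunct1[OF ins] conjunct2[OF ins] by simp
    then show False using min[OF U'(1)] C(4) C'(4) by simp
  qed
  with U show ?thesis by blast
qed

section \<open>The module \<open>\<pi>(\<alpha>)\<close>\<close>

text \<open>This is multiplication by t^r on V_1 \<otimes> A.\<close>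

definition shift :: "'a::ab_group_add \<Rightarrow> ('a \<Rightarrow>\<^sub>0 'b::zero) \<Rightarrow> ('a \<Rightarrow>\<^sub>0 'b)" where
  "shift r f = Poly_Mapping.map_key (\<lambda>p. p - r) f"

lemma lookup_shift [simp]:
  "poly_mapping.lookup (shift r f) p = poly_mapping.lookup f (p - r)"
proof -
  have "inj (\<lambda>p. p - r)" by (auto simp: inj_on_def)
  then show ?thesis by (simp add: shift_def map_key.rep_eq)
qed

lemma shift_shift: "shift r (shift s f) = shift (r + s) f"
  by (rule poly_mapping_eqI) (simp add: diff_diff_eq)

lemma shift_zero: "shift 0 f = f"
  by (rule poly_mapping_eqI) simp

lemma shift_single: "shift r (Poly_Mapping.single p v) = Poly_Mapping.single (p + r) v"
  by (rule poly_mapping_eqI) (auto simp: lookup_single when_def)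

lemma shift_linear: "clinear (shift r :: ('a::ab_group_add \<Rightarrow>\<^sub>0 'b::complex_vector) \<Rightarrow> _)"
  by (rule clinearI; rule poly_mapping_eqI) (simp_all add: lookup_add)

context irreducible_weight_module
begin

section \<open>Coefficients and linearity of the action \<pi>(\<alpha>)\<close>

lemma pi_act_JD_elem:
  "pi_act \<alpha> act (JD_elem X m) f = (\<Sum>p\<in>Poly_Mapping.keys f.
    Poly_Mapping.single (m + p) (act (JD_elem X m) (poly_mapping.lookup f p)))"
proof -
  have "Poly_Mapping.mapp (\<lambda>p v. (\<Sum>i\<in>UNIV. (0 :: complex ^ 'm option) $ Some i *
      (\<alpha> $ i + of_int (p $ i))) *\<^sub>C v + ((0 :: complex ^ 'm option) $ None) *\<^sub>C act (JD_d None) v) f = 0"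
    by (rule poly_mapping_eqI) (simp add: lookup_mapp)
  moreover have "fst (JD_elem X m) = Poly_Mapping.single m X" "snd (JD_elem X m) = 0"
    by (simp_all add: JD_elem_def)
  ultimately show ?thesis
    by (cases "X = 0") (simp_all add: pi_act_def act_elem_0)
qed

lemma lookup_pi_act_JD_elem:
  "poly_mapping.lookup (pi_act \<alpha> act (JD_elem X m) f) p =
    act (JD_elem X m) (poly_mapping.lookup f (p - m))"
proof -
  have "poly_mapping.lookup (pi_act \<alpha> act (JD_elem X m) f) p =
      (\<Sum>q\<in>Poly_Mapping.keys f. if q = p - m then act (JD_elem X m) (poly_mapping.lookup f q) else 0)"
    unfolding pi_act_JD_elem lookup_sum
    by (intro sum.cong) (auto simp: lookup_single when_def)
  also have "\<dots> = act (JD_elem X m) (poly_mapping.lookup f (p - m))"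
    by (simp add: clinear_0[OF act_elem_linear] in_keys_iff)
  finally show ?thesis .
qed

lemma lookup_pi_act_deriv:
  "poly_mapping.lookup (pi_act \<alpha> act (0, \<delta>) f) p =
    (\<Sum>i\<in>UNIV. \<delta> $ Some i * (\<alpha> $ i + of_int (p $ i))) *\<^sub>C poly_mapping.lookup f p +
    (\<delta> $ None) *\<^sub>C act (JD_d None) (poly_mapping.lookup f p)"
  by (simp add: pi_act_def lookup_mapp when_def in_keys_iff clinear_0[OF act_d_linear])

lemma pi_act_decomposition:
  "pi_act \<alpha> act X f = (\<Sum>m\<in>Poly_Mapping.keys (fst X).
    pi_act \<alpha> act (JD_elem (poly_mapping.lookup (fst X) m) m) f) + pi_act \<alpha> act (0, snd X) f"
  unfolding pi_act_JD_elem by (simp add: pi_act_def)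

lemma pi_act_JD_elem_linear: "clinear (pi_act \<alpha> act (JD_elem X m))"
  by (rule clinearI; rule poly_mapping_eqI)
    (simp_all add: lookup_pi_act_JD_elem lookup_add clinear_add clinear_scale act_elem_linear)

lemma pi_act_deriv_linear: "clinear (pi_act \<alpha> act (0, \<delta>))"
  by (rule clinearI; rule poly_mapping_eqI)
    (simp_all add: lookup_pi_act_deriv lookup_add clinear_add clinear_scale act_d_linear
      scaleC_add_right scaleC_scaleC mult.commute)

lemma pi_act_linear: "clinear (pi_act \<alpha> act X)"
proof -
  have eq: "pi_act \<alpha> act X = (\<lambda>f. (\<Sum>m\<in>Poly_Mapping.keys (fst X).
      pi_act \<alpha> act (JD_elem (poly_mapping.lookup (fst X) m) m) f) + pi_act \<alpha> act (0, snd X) f)"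
    by (rule ext) (rule pi_act_decomposition)
  show ?thesis
    by (subst eq, rule clinearI)
      (simp_all add: clinear_add clinear_scale pi_act_JD_elem_linear pi_act_deriv_linear
        sum.distrib scaleC_add_right complex_vector.scale_sum_right)
qed

section \<open>Graded submodules of V_1 \<otimes> A\<close>

abbreviation "pi_submodule \<alpha> S \<equiv> submodule (JD_sub UNIV) (pi_act \<alpha> act) S"

lemma pi_submoduleI:
  assumes "csubspace S"
    and "\<And>X m f. f \<in> S \<Longrightarrow> pi_act \<alpha> act (JD_elem X m) f \<in> S"
    and "\<And>\<delta> f. f \<in> S \<Longrightarrow> pi_act \<alpha> act (0, \<delta>) f \<in> S"
  shows "pi_submodule \<alpha> S"
  unfolding submodule_def
proof (intro conjI ballI assms(1))
  fix X :: "('g, 'm) JD" and f assume "f \<in> S"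
  then show "pi_act \<alpha> act X f \<in> S"
    by (subst pi_act_decomposition)
      (simp add: assms complex_vector.subspace_add complex_vector.subspace_sum)
qed

lemma pi_submodule_subspace: "pi_submodule \<alpha> S \<Longrightarrow> csubspace S"
  by (simp add: submodule_def)

lemma pi_submodule_act: "pi_submodule \<alpha> S \<Longrightarrow> f \<in> S \<Longrightarrow> pi_act \<alpha> act X f \<in> S"
  by (cases X) (auto simp: submodule_def JD_sub_def)

lemma pi_submodule_elem:
  assumes "pi_submodule \<alpha> S" "Poly_Mapping.single p v \<in> S"
  shows "Poly_Mapping.single (m + p) (act (JD_elem X m) v) \<in> S"
proof -
  have "pi_act \<alpha> act (JD_elem X m) (Poly_Mapping.single p v) =
      Poly_Mapping.single (m + p) (act (JD_elem X m) v)"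
    by (rule pi_act_elem) (auto simp: act_elem_0 act_elem_linear)
  then show ?thesis using pi_submodule_act[OF assms, of "JD_elem X m"] by simp
qed

lemma pi_submodule_d:
  assumes "pi_submodule \<alpha> S" "Poly_Mapping.single p v \<in> S"
  shows "Poly_Mapping.single p (act (JD_d None) v) \<in> S"
  using pi_submodule_act[OF assms, of "JD_d None"] pi_act_d(2)[where act = act, OF act_d_linear, of \<alpha> p v] by simp

text \<open>The joint eigenvalues \<open>\<alpha> $ i + p $ i\<close> of d_1, ..., d_(n-1) separate
  the exponents, whatever \<alpha> is.\<close>

lemma pi_submodule_homogeneous:
  assumes S: "pi_submodule \<alpha> S" and f: "f \<in> S"
  shows "Poly_Mapping.single p (poly_mapping.lookup f p) \<in> S"
proof (cases "p \<in> Poly_Mapping.keys f")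
  case True
  let ?w = "\<lambda>p. Poly_Mapping.single p (poly_mapping.lookup f p)"
  show ?thesis
  proof (rule stable_subspace_components[where S = S and B = UNIV and M = "Poly_Mapping.keys f"
        and T = "\<lambda>i. pi_act \<alpha> act (JD_d (Some i))" and w = ?w
        and e = "\<lambda>p i. \<alpha> $ i + of_int (p $ i)"])
    show "csubspace S" using S by (rule pi_submodule_subspace)
    show "clinear (pi_act \<alpha> act (JD_d (Some i)))" for i by (rule pi_act_linear)
    show "pi_act \<alpha> act (JD_d (Some i)) x \<in> S" if "x \<in> S" for i x
      using S that by (rule pi_submodule_act)
    show "pi_act \<alpha> act (JD_d (Some i)) (?w p) = (\<alpha> $ i + of_int (p $ i)) *\<^sub>C ?w p" for i p
      by (rule pi_act_d(1)[where act = act, OF act_d_linear])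
    show "\<exists>i\<in>UNIV. \<alpha> $ i + of_int (p $ i) \<noteq> \<alpha> $ i + of_int (p' $ i)" if "p \<noteq> p'" for p p' :: "int ^ 'm"
      using that by (simp add: vec_eq_iff)
    have "sum ?w (Poly_Mapping.keys f) = f"
      by (rule poly_mapping_eqI) (simp add: lookup_sum lookup_single when_def in_keys_iff)
    then show "sum ?w (Poly_Mapping.keys f) \<in> S" using f by simp
  qed (use True in simp_all)
next
  case False
  then have "Poly_Mapping.single p (poly_mapping.lookup f p) = 0" by (simp add: in_keys_iff)
  then show ?thesis using complex_vector.subspace_0[OF pi_submodule_subspace[OF S]] by simp
qed

text \<open>X(m) moves the component at \<open>p\<close> to \<open>m + p\<close>, so the components
  at one exponent need not be stable, but those at all exponents together are. Forgetting the
  exponents thus yields a submodule of the irreducible V_1.\<close>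

lemma span_components:
  assumes S: "pi_submodule \<alpha> S" "S \<noteq> {0}"
  shows "cspan {v. \<exists>p. Poly_Mapping.single p v \<in> S} = UNIV"
proof -
  let ?G = "{v. \<exists>p. Poly_Mapping.single p v \<in> S}"
  have "submodule (JD_sub {None}) act (cspan ?G)"
  proof (rule submoduleI[OF complex_vector.subspace_span])
    fix X m v assume v: "v \<in> cspan ?G"
    have "?G \<subseteq> {v. act (JD_elem X m) v \<in> cspan ?G}"
    proof
      fix u assume "u \<in> ?G"
      then obtain p where "Poly_Mapping.single p u \<in> S" by blast
      then have "act (JD_elem X m) u \<in> ?G" using pi_submodule_elem[OF S(1)] by blast
      then show "u \<in> {v. act (JD_elem X m) v \<in> cspan ?G}" by (simp add: complex_vector.span_base)
    qed
    then have "cspan ?G \<subseteq> {v. act (JD_elem X m) v \<in> cspan ?G}"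
      by (rule complex_vector.span_minimal)
        (rule subspace_vimage[OF act_elem_linear complex_vector.subspace_span])
    then show "act (JD_elem X m) v \<in> cspan ?G" using v by blast
  next
    fix v assume v: "v \<in> cspan ?G"
    have "?G \<subseteq> {v. act (JD_d None) v \<in> cspan ?G}"
    proof
      fix u assume "u \<in> ?G"
      then obtain p where "Poly_Mapping.single p u \<in> S" by blast
      then have "act (JD_d None) u \<in> ?G" using pi_submodule_d[OF S(1)] by blast
      then show "u \<in> {v. act (JD_d None) v \<in> cspan ?G}" by (simp add: complex_vector.span_base)
    qed
    then have "cspan ?G \<subseteq> {v. act (JD_d None) v \<in> cspan ?G}"
      by (rule complex_vector.span_minimal)
        (rule subspace_vimage[OF act_d_linear complex_vector.subspace_span])
    then show "act (JD_d None) v \<in> cspan ?G" using v by blast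
  qed
  moreover have "cspan ?G \<noteq> {0}"
  proof
    assume 0: "cspan ?G = {0}"
    have "f = 0" if "f \<in> S" for f
    proof (rule poly_mapping_eqI)
      fix p
      have "poly_mapping.lookup f p \<in> ?G"
        using pi_submodule_homogeneous[OF S(1) that] by blast
      then have "poly_mapping.lookup f p \<in> cspan ?G" by (rule complex_vector.span_base)
      then show "poly_mapping.lookup f p = poly_mapping.lookup 0 p" using 0 by simp
    qed
    then show False using S complex_vector.subspace_0[OF pi_submodule_subspace[OF S(1)]] by blast
  qed
  ultimately show ?thesis using submodule_trivial by blast
qed

text \<open>Any one weight space \<open>R\<close> detects all non-zero submodules. The components of
  \<open>S\<close> at a fixed exponent split into weight vectors inside \<open>S\<close>; if none
  lay in \<open>R\<close>, they would all lie in the sum of the other weight spaces and could not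
  span V_1.\<close>

lemma weight_component_exists:
  assumes S: "pi_submodule \<alpha> S" "S \<noteq> {0}" and R: "R \<in> weights" "R \<noteq> {0}"
  shows "\<exists>p. \<exists>v\<in>R. v \<noteq> 0 \<and> Poly_Mapping.single p v \<in> S"
proof (rule ccontr)
  assume none: "\<not> ?thesis"
  let ?G = "{v. \<exists>p. Poly_Mapping.single p v \<in> S}"
  let ?C = "cspan (\<Union>(weights - {R}))"
  have "v \<in> ?C" if v: "Poly_Mapping.single p v \<in> S" for p v
  proof -
    obtain M w where M: "finite M" "M \<subseteq> weights" "\<forall>Q\<in>M. w Q \<in> Q" and sum: "v = sum w M"
      using weight_decomposition[of v] by blast
    let ?U = "{u. Poly_Mapping.single p u \<in> S}"
    have "clinear (Poly_Mapping.single p :: 'w \<Rightarrow> _)"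
      by (rule clinearI) (simp_all add: single_add scaleC_single)
    then have U: "csubspace ?U"
      by (rule subspace_vimage) (rule pi_submodule_subspace[OF S(1)])
    have "act h u \<in> ?U" if h: "h \<in> T" and u: "u \<in> ?U" for h u
    proof -
      \<comment> \<open>Torus elements have exponent 0 in t_1, ..., t_(n-1), so they do not move
        \<open>p\<close>.\<close>
      have keys: "Poly_Mapping.keys (fst h) \<subseteq> {0}"
        using h by (auto simp: h_sub_def JD_elem_def split: if_splits)
      have "act (JD_elem (poly_mapping.lookup (fst h) m) m) u \<in> ?U"
        if "m \<in> Poly_Mapping.keys (fst h)" for m
      proof -
        have m: "m = 0" using that keys by blast
        show ?thesis
          using pi_submodule_elem[OF S(1), of p u 0 "poly_mapping.lookup (fst h) m"] u
          by (simp add: m)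
      qed
      moreover have "act (JD_d None) u \<in> ?U" using pi_submodule_d[OF S(1)] u by blast
      ultimately show ?thesis
        unfolding act_decomposition[OF T_subset[OF h]]
        by (intro complex_vector.subspace_add[OF U] complex_vector.subspace_sum[OF U]
            complex_vector.subspace_scale[OF U])
    qed
    then have w: "w Q \<in> ?U" if "Q \<in> M" for Q
      by (rule weight_components[OF U _ M(1,2) _ _ that]) (use M(3) v sum in auto)
    have "w Q \<in> ?C" if Q: "Q \<in> M" for Q
    proof (cases "Q = R")
      case True
      then have "w Q = 0" using w[OF Q] M(3) Q none by blast
      then show ?thesis by (simp add: complex_vector.span_zero)
    next
      case False
      then have "w Q \<in> \<Union>(weights - {R})" using Q M by blast
      then show ?thesis by (rule complex_vector.span_base)
    qed
    then show ?thesis unfolding sum by (rule complex_vector.span_sum)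
  qed
  then have "?G \<subseteq> ?C" by blast
  then have "cspan ?G \<subseteq> ?C"
    by (rule complex_vector.span_minimal) (rule complex_vector.subspace_span)
  then have "R \<subseteq> ?C" using span_components[OF S] by blast
  then show False using independent_weights[OF R(1)] R(2) by blast
qed

section \<open>Translations of exponents that preserve every submodule\<close>

definition shifts :: "complex ^ 'm \<Rightarrow> (int ^ 'm) set" where
  "shifts \<alpha> = {r. \<forall>S p v. pi_submodule \<alpha> S \<longrightarrow> Poly_Mapping.single p v \<in> S \<longrightarrow>
    Poly_Mapping.single (p + r) v \<in> S}"

lemma shiftsD:
  "r \<in> shifts \<alpha> \<Longrightarrow> pi_submodule \<alpha> S \<Longrightarrow> Poly_Mapping.single p v \<in> S \<Longrightarrow>
    Poly_Mapping.single (p + r) v \<in> S"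
  by (simp add: shifts_def)

lemma shifts_zero: "0 \<in> shifts \<alpha>"
  by (simp add: shifts_def)

lemma shifts_add: "r \<in> shifts \<alpha> \<Longrightarrow> s \<in> shifts \<alpha> \<Longrightarrow> r + s \<in> shifts \<alpha>"
  by (simp add: shifts_def add.assoc[symmetric])

lemma shifts_sum: "(\<And>i. i \<in> A \<Longrightarrow> f i \<in> shifts \<alpha>) \<Longrightarrow> sum f A \<in> shifts \<alpha>"
  by (induction A rule: infinite_finite_induct) (auto intro: shifts_zero shifts_add)

lemma shifts_multiple: "r \<in> shifts \<alpha> \<Longrightarrow> int n *s r \<in> shifts \<alpha>"
proof (induction n)
  case 0
  then show ?case by (simp add: shifts_zero)
next
  case (Suc n)
  have "int (Suc n) *s r = r + int n *s r" by (simp add: vec_eq_iff algebra_simps)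
  then show ?case using Suc shifts_add by simp
qed

lemma charge_shift:
  assumes "charge m \<noteq> 0"
  shows "m \<in> shifts \<alpha>"
  unfolding shifts_def
proof (intro CollectI allI impI)
  fix S p v assume S: "pi_submodule \<alpha> S" and v: "Poly_Mapping.single p v \<in> S"
  have "charge m *\<^sub>C Poly_Mapping.single (m + p) v \<in> S"
    using pi_submodule_elem[OF S v, of m aff_K] by (simp add: act_K scaleC_single)
  then have "inverse (charge m) *\<^sub>C charge m *\<^sub>C Poly_Mapping.single (m + p) v \<in> S"
    by (rule complex_vector.subspace_scale[OF pi_submodule_subspace[OF S]])
  then show "Poly_Mapping.single (p + m) v \<in> S"
    using assms by (simp add: add.commute)
qed

text \<open>\<open>shifts \<alpha>\<close> is closed under addition, but not visibly under negation.
  One negative multiple with non-zero charge repairs this: -m = -(i+1)m + im.\<close>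

lemma charge_shift_uminus:
  assumes "charge m \<noteq> 0"
  shows "- m \<in> shifts \<alpha>"
proof -
  obtain i :: nat where "charge (- int (Suc i) *s m) \<noteq> 0"
    using charge_negative_multiple[OF assms] by blast
  then have "- int (Suc i) *s m + int i *s m \<in> shifts \<alpha>"
    by (intro shifts_add shifts_multiple charge_shift assms)
  moreover have "- int (Suc i) *s m + int i *s m = - m" by (simp add: vec_eq_iff algebra_simps)
  ultimately show ?thesis by simp
qed

text \<open>Multiplication by t^r commutes with J but is not a homomorphism, since d_i changes by
  the scalar r_i. The correction is a multiple of \<open>shift r g\<close>, which lies in the image,
  so submodules still go to submodules.\<close>

lemma pi_submodule_shift:
  assumes S: "pi_submodule \<alpha> S"
  shows "pi_submodule \<alpha> (shift r ` S)"
proof (rule pi_submoduleI)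
  have "shift r ` S = {f. shift (- r) f \<in> S}"
  proof (intro equalityI subsetI)
    fix f assume "f \<in> {f. shift (- r) f \<in> S}"
    then have "shift r (shift (- r) f) \<in> shift r ` S" by blast
    then show "f \<in> shift r ` S" by (simp add: shift_shift shift_zero)
  qed (auto simp: shift_shift shift_zero)
  then show sub: "csubspace (shift r ` S)"
    using subspace_vimage[OF shift_linear pi_submodule_subspace[OF S], of "- r"] by simp
  fix f assume "f \<in> shift r ` S"
  then obtain g where g: "g \<in> S" and f: "f = shift r g" by blast
  show "pi_act \<alpha> act (JD_elem X m) f \<in> shift r ` S" for X m
  proof -
    have "pi_act \<alpha> act (JD_elem X m) f = shift r (pi_act \<alpha> act (JD_elem X m) g)"
      by (rule poly_mapping_eqI) (simp add: f lookup_pi_act_JD_elem algebra_simps)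
    then show ?thesis using pi_submodule_act[OF S g] by blast
  qed
  show "pi_act \<alpha> act (0, \<delta>) f \<in> shift r ` S" for \<delta>
  proof -
    let ?c = "\<Sum>i\<in>UNIV. \<delta> $ Some i * of_int (r $ i)"
    have "pi_act \<alpha> act (0, \<delta>) f = shift r (pi_act \<alpha> act (0, \<delta>) g) + ?c *\<^sub>C shift r g"
    proof (rule poly_mapping_eqI)
      fix p
      have "(\<Sum>i\<in>UNIV. \<delta> $ Some i * (\<alpha> $ i + of_int (p $ i))) =
          (\<Sum>i\<in>UNIV. \<delta> $ Some i * (\<alpha> $ i + of_int ((p - r) $ i))) + ?c"
        unfolding sum.distrib[symmetric] by (intro sum.cong) (simp_all add: algebra_simps)
      then show "poly_mapping.lookup (pi_act \<alpha> act (0, \<delta>) f) p =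
          poly_mapping.lookup (shift r (pi_act \<alpha> act (0, \<delta>) g) + ?c *\<^sub>C shift r g) p"
        by (simp add: f lookup_pi_act_deriv lookup_add scaleC_add_left)
    qed
    then show ?thesis
      using pi_submodule_act[OF S g] g
      by (auto intro!: complex_vector.subspace_add[OF sub] complex_vector.subspace_scale[OF sub])
  qed
qed

lemma irreducible_shift:
  assumes "irreducible_submodule (JD_sub UNIV) (pi_act \<alpha> act) S"
  shows "irreducible_submodule (JD_sub UNIV) (pi_act \<alpha> act) (shift r ` S)"
proof -
  have S: "pi_submodule \<alpha> S" "S \<noteq> {0}"
    and min: "\<And>R. pi_submodule \<alpha> R \<Longrightarrow> R \<subseteq> S \<Longrightarrow> R = {0} \<or> R = S"
    using assms unfolding irreducible_submodule_def by blast+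
  have inv: "shift s ` shift (- s) ` R = R" for s and R :: "((int ^ 'm) \<Rightarrow>\<^sub>0 'w) set"
    by (simp add: image_image shift_shift shift_zero)
  have zero: "shift s ` {0} = {0 :: (int ^ 'm) \<Rightarrow>\<^sub>0 'w}" for s
    using clinear_0[OF shift_linear] by simp
  have "shift r ` S \<noteq> {0}" using inv[of "- r" S] zero S(2) by auto
  moreover have "R = {0} \<or> R = shift r ` S" if R: "pi_submodule \<alpha> R" "R \<subseteq> shift r ` S" for R
  proof -
    have "shift (- r) ` R \<subseteq> shift (- r) ` shift r ` S" using R(2) by (rule image_mono)
    then have "shift (- r) ` R \<subseteq> S" using inv[of "- r" S] by simp
    then have "shift (- r) ` R = {0} \<or> shift (- r) ` R = S"
      by (intro min pi_submodule_shift R(1))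
    then show ?thesis using inv[of r R] zero[of r] by auto
  qed
  ultimately show ?thesis
    using pi_submodule_shift[OF S(1)] unfolding irreducible_submodule_def by blast
qed

text \<open>Only sums and natural multiples are available, so both signs of every generator are
  required.\<close>

lemma shifts_lattice:
  assumes "\<And>i. axis i (k i) \<in> shifts \<alpha>" "\<And>i. - axis i (k i) \<in> shifts \<alpha>"
  shows "(\<chi> i. k i * c i) \<in> shifts \<alpha>"
proof -
  have "c i *s axis i (k i) \<in> shifts \<alpha>" for i
  proof (cases "c i \<ge> 0")
    case True
    then show ?thesis using shifts_multiple[OF assms(1), of "nat (c i)" i] by simp
  next
    case False
    then have "c i *s axis i (k i) = int (nat (- c i)) *s - axis i (k i)"
      by (simp add: vec_eq_iff)
    then show ?thesis using shifts_multiple[OF assms(2), of "nat (- c i)" i] by simp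
  qed
  then have "(\<Sum>i\<in>UNIV. c i *s axis i (k i)) \<in> shifts \<alpha>" by (rule shifts_sum)
  moreover have "(\<Sum>i\<in>UNIV. c i *s axis i (k i)) = (\<chi> i. k i * c i)"
    by (simp add: vec_eq_iff axis_def if_distrib[of "\<lambda>x. _ * x"] mult.commute cong: if_cong)
  ultimately show ?thesis by simp
qed

text \<open>Every non-zero submodule meets the finite dimensional \<open>?E\<close>, which contains
  \<open>R\<close> over the exponents in \<open>P\<close>: a non-zero vector of \<open>R\<close>
  occurs in the submodule at some exponent, and a preserved translation moves it into
  \<open>P\<close>. Minimality is therefore a matter of dimension in \<open>?E\<close>.\<close>

lemma irreducible_pi_submodule_exists:
  assumes "finite P" and P: "\<And>p. \<exists>p'\<in>P. p' - p \<in> shifts \<alpha>"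
  shows "\<exists>S. irreducible_submodule (JD_sub UNIV) (pi_act \<alpha> act) S"
proof -
  obtain R v where R: "R \<in> weights" "v \<in> R" "v \<noteq> 0" by (rule nonzero_weight)
  then have "R \<noteq> {0}" by blast
  have "finite_dim (cspan (\<Union>{R}))" by (rule finite_dim_weight_sum) (simp_all add: R)
  then obtain B where B: "finite B" "cspan (\<Union>{R}) \<subseteq> cspan B" using finite_dim_def by blast
  have RB: "R \<subseteq> cspan B" using B(2) complex_vector.span_superset[of R] by simp
  let ?G = "\<Union>p\<in>P. Poly_Mapping.single p ` B"
  let ?E = "cspan ?G"
  have E: "finite_dim ?E"
    unfolding finite_dim_def using assms(1) B(1) by (intro exI[of _ ?G]) auto
  have single_E: "Poly_Mapping.single p u \<in> ?E" if "p \<in> P" "u \<in> R" for p u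
  proof -
    have lin: "clinear (Poly_Mapping.single p :: 'w \<Rightarrow> _)"
      by (rule clinearI) (simp_all add: single_add scaleC_single)
    have "Poly_Mapping.single p u \<in> Poly_Mapping.single p ` cspan B" using RB that(2) by blast
    then have "Poly_Mapping.single p u \<in> cspan (Poly_Mapping.single p ` B)"
      by (simp only: span_image_clinear[OF lin])
    moreover have "Poly_Mapping.single p ` B \<subseteq> ?G" using that(1) by blast
    ultimately show ?thesis using complex_vector.span_mono by blast
  qed
  have meets: "S \<inter> ?E \<noteq> {0}" if S: "pi_submodule \<alpha> S" "S \<noteq> {0}" for S
  proof -
    obtain p u where u: "u \<in> R" "u \<noteq> 0" "Poly_Mapping.single p u \<in> S"
      using weight_component_exists[OF S R(1) \<open>R \<noteq> {0}\<close>] by blast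
    obtain p' where p': "p' \<in> P" "p' - p \<in> shifts \<alpha>" using P by blast
    have "Poly_Mapping.single p' u \<in> S" using shiftsD[OF p'(2) S(1) u(3)] by simp
    moreover have "Poly_Mapping.single p' u \<in> ?E" by (rule single_E[OF p'(1) u(1)])
    moreover have "Poly_Mapping.single p' u \<noteq> 0" using u(2) by (metis lookup_single_eq lookup_zero)
    ultimately show ?thesis by blast
  qed
  let ?F = "{S \<inter> ?E | S. pi_submodule \<alpha> S \<and> S \<noteq> {0}}"
  have "pi_submodule \<alpha> UNIV" by (simp add: submodule_def complex_vector.subspace_UNIV)
  moreover have "(UNIV :: ((int ^ 'm) \<Rightarrow>\<^sub>0 'w) set) \<noteq> {0}"
  proof
    assume "(UNIV :: ((int ^ 'm) \<Rightarrow>\<^sub>0 'w) set) = {0}"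
    then have "Poly_Mapping.single (0 :: int ^ 'm) v = 0" by blast
    then show False using R(3) by (metis lookup_single_eq lookup_zero)
  qed
  ultimately have "?F \<noteq> {}" by blast
  moreover have "csubspace U \<and> U \<subseteq> ?E" if "U \<in> ?F" for U
    using that pi_submodule_subspace
    by (auto intro: complex_vector.subspace_inter complex_vector.subspace_span)
  ultimately have "\<exists>U\<in>?F. \<forall>U'\<in>?F. U' \<subseteq> U \<longrightarrow> U' = U"
    by (rule finite_dim_minimal_subspace[OF E])
  then obtain U where U: "U \<in> ?F" and U_min: "\<forall>U'\<in>?F. U' \<subseteq> U \<longrightarrow> U' = U" by (elim bexE)
  from U obtain S where S: "pi_submodule \<alpha> S" "S \<noteq> {0}" and US: "U = S \<inter> ?E" by blast
  have min: "S' \<inter> ?E = S \<inter> ?E"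
    if S': "pi_submodule \<alpha> S'" "S' \<noteq> {0}" "S' \<inter> ?E \<subseteq> S \<inter> ?E" for S'
  proof -
    have "S' \<inter> ?E \<in> ?F" using S'(1,2) by blast
    then show ?thesis using U_min S'(3) US by simp
  qed
  \<comment> \<open>The submodule generated by \<open>S \<inter> ?E\<close>. A non-zero submodule
    inside it has the same trace on \<open>?E\<close> by minimality, hence contains the generators;
    this argument would not apply to \<open>S\<close> itself.\<close>
  let ?S = "\<Inter>{Q. pi_submodule \<alpha> Q \<and> S \<inter> ?E \<subseteq> Q}"
  have sub: "pi_submodule \<alpha> ?S" by (rule submodule_Inter) simp
  have "?S \<subseteq> S" using S(1) by auto
  have "S \<inter> ?E \<subseteq> ?S" by auto
  moreover have "0 \<in> S \<inter> ?E"
    using complex_vector.subspace_0[OF pi_submodule_subspace[OF S(1)]] complex_vector.span_zero by simp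
  ultimately have "?S \<noteq> {0}" using meets[OF S] by auto
  moreover have "Q = {0} \<or> Q = ?S" if Q: "pi_submodule \<alpha> Q" "Q \<subseteq> ?S" for Q
  proof (cases "Q = {0}")
    case False
    have "Q \<inter> ?E \<subseteq> S \<inter> ?E" using Q(2) \<open>?S \<subseteq> S\<close> by (intro Int_mono) auto
    then have "Q \<inter> ?E = S \<inter> ?E" using Q(1) False by (intro min)
    then have "S \<inter> ?E \<subseteq> Q" by blast
    then have "?S \<subseteq> Q" using Q(1) by (intro Inter_lower) simp
    with Q(2) have "Q = ?S" by (rule subset_antisym)
    then show ?thesis by (rule disjI2)
  qed simp
  ultimately show ?thesis
    using sub unfolding irreducible_submodule_def by (intro exI[of _ ?S] conjI allI impI) simp_all
qed

lemma pi_completely_reducible: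
  assumes k: "\<And>i. k i > 0"
    and shifts: "\<And>i. axis i (k i) \<in> shifts \<alpha>" "\<And>i. - axis i (k i) \<in> shifts \<alpha>"
  shows "completely_reducible (JD_sub UNIV) (pi_act \<alpha> act)"
proof -
  let ?P = "{p :: int ^ 'm. \<forall>i. p $ i \<in> {0..<k i}}"
  have "?P \<subseteq> vec_lambda ` (PiE UNIV (\<lambda>i. {0..<k i}))"
  proof
    fix p assume "p \<in> ?P"
    then have "($) p \<in> PiE UNIV (\<lambda>i. {0..<k i})" by auto
    moreover have "p = vec_lambda (($) p)" by (simp add: vec_nth_inverse)
    ultimately show "p \<in> vec_lambda ` (PiE UNIV (\<lambda>i. {0..<k i}))" by blast
  qed
  moreover have "finite (PiE (UNIV :: 'm set) (\<lambda>i. {0..<k i}))" by (rule finite_PiE) simp_all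
  ultimately have P: "finite ?P" using finite_surj by blast
  have rep: "\<exists>p'\<in>?P. p' - p \<in> shifts \<alpha>" for p
  proof
    let ?p = "\<chi> i. p $ i mod k i"
    show "?p \<in> ?P" using k by simp
    have "?p - p = (\<chi> i. k i * - (p $ i div k i))"
      by (simp add: vec_eq_iff minus_div_mult_eq_mod[symmetric] algebra_simps)
    then show "?p - p \<in> shifts \<alpha>" by (simp only: shifts_lattice[OF shifts])
  qed
  obtain S where S: "irreducible_submodule (JD_sub UNIV) (pi_act \<alpha> act) S"
    using irreducible_pi_submodule_exists[OF P rep] by blast
  then have sub: "pi_submodule \<alpha> S" "S \<noteq> {0}" by (simp_all add: irreducible_submodule_def)
  \<comment> \<open>A set of translates, so translates that coincide are counted once.\<close>
  let ?\<S> = "(\<lambda>r. shift r ` S) ` ?P"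
  let ?G = "{v. \<exists>p. Poly_Mapping.single p v \<in> S}"
  have single: "Poly_Mapping.single p v \<in> cspan (\<Union>?\<S>)" for p v
  proof -
    have "?G \<subseteq> {v. Poly_Mapping.single p v \<in> cspan (\<Union>?\<S>)}"
    proof
      fix u assume "u \<in> ?G"
      then obtain t where t: "Poly_Mapping.single t u \<in> S" by blast
      \<comment> \<open>A vector at exponent \<open>t\<close> reaches \<open>p\<close> in two moves:
        by a lattice vector, inside \<open>S\<close>, to \<open>p - ?r\<close>, and then by the
        translation \<open>?r\<close> from the box.\<close>
      let ?r = "\<chi> i. (p - t) $ i mod k i"
      have rP: "?r \<in> ?P" using k by simp
      have "(p - ?r) - t = (\<chi> i. k i * ((p - t) $ i div k i))"
        by (simp add: vec_eq_iff minus_div_mult_eq_mod[symmetric] algebra_simps)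
      then have "(p - ?r) - t \<in> shifts \<alpha>" by (simp only: shifts_lattice[OF shifts])
      then have "Poly_Mapping.single (t + ((p - ?r) - t)) u \<in> S" by (rule shiftsD[OF _ sub(1) t])
      then have "shift ?r (Poly_Mapping.single (p - ?r) u) \<in> shift ?r ` S" by simp
      then have "Poly_Mapping.single p u \<in> shift ?r ` S" by (simp add: shift_single)
      then have "Poly_Mapping.single p u \<in> \<Union>?\<S>" using rP by blast
      then show "u \<in> {v. Poly_Mapping.single p v \<in> cspan (\<Union>?\<S>)}"
        by (simp add: complex_vector.span_base)
    qed
    moreover have "clinear (Poly_Mapping.single p :: 'w \<Rightarrow> _)"
      by (rule clinearI) (simp_all add: single_add scaleC_single)
    ultimately have "cspan ?G \<subseteq> {v. Poly_Mapping.single p v \<in> cspan (\<Union>?\<S>)}"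
      by (intro complex_vector.span_minimal subspace_vimage complex_vector.subspace_span)
    then show ?thesis using span_components[OF sub] by blast
  qed
  have "f \<in> cspan (\<Union>?\<S>)" for f
  proof -
    have "f = (\<Sum>p\<in>Poly_Mapping.keys f. Poly_Mapping.single p (poly_mapping.lookup f p))"
      by (rule poly_mapping_eqI) (simp add: lookup_sum lookup_single when_def in_keys_iff)
    also have "\<dots> \<in> cspan (\<Union>?\<S>)" by (intro complex_vector.span_sum single)
    finally show ?thesis .
  qed
  then have "cspan (\<Union>?\<S>) = UNIV" by blast
  then show ?thesis
    using P irreducible_shift[OF S]
    by (intro completely_reducible_finite_sum[where \<S> = ?\<S>] pi_act_linear) auto
qed

end

section \<open>Central operators\<close>

text \<open>The hypothesis is weaker than commuting, because on V the operator K_n(m) commutes with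
  d_i only up to the multiple m_i of itself. Kernel and range are submodules all the same.\<close>

lemma irreducible_bijective:
  fixes act :: "'l::complex_vector \<Rightarrow> 'v::complex_vector \<Rightarrow> 'v"
  assumes irr: "irreducible_submodule L act UNIV" and lin: "\<And>X. X \<in> L \<Longrightarrow> clinear (act X)"
    and f: "clinear f" "f \<noteq> (\<lambda>v. 0)"
    and comm: "\<And>X. X \<in> L \<Longrightarrow> \<exists>c. \<forall>v. act X (f v) = f (act X v) + c *\<^sub>C f v"
  shows "bij f"
proof -
  have min: "S = {0} \<or> S = UNIV" if "submodule L act S" for S
    using irr that by (auto simp: irreducible_submodule_def)
  have "submodule L act {v. f v = 0}"
    unfolding submodule_def
  proof (intro conjI ballI subspace_kernel f(1))
    fix X v assume X: "X \<in> L" and v: "v \<in> {v. f v = 0}"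
    from comm[OF X] obtain c where "\<forall>v. act X (f v) = f (act X v) + c *\<^sub>C f v" by (elim exE)
    then have "act X (f v) = f (act X v) + c *\<^sub>C f v" by (rule spec)
    then show "act X v \<in> {v. f v = 0}" using v clinear_0[OF lin[OF X]] by simp
  qed
  from min[OF this] have kernel: "v = 0" if "f v = 0" for v
  proof
    assume "{v. f v = 0} = {0}"
    then show ?thesis using that by (simp add: set_eq_iff)
  next
    assume "{v. f v = 0} = UNIV"
    then have "f = (\<lambda>v. 0)" by (simp add: set_eq_iff fun_eq_iff)
    with f(2) show ?thesis by (rule notE)
  qed
  have "inj f"
  proof (rule injI)
    fix x y assume "f x = f y"
    then have "f (x - y) = 0" by (simp add: clinear_diff[OF f(1)])
    then have "x - y = 0" by (rule kernel)
    then show "x = y" by simp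
  qed
  have "submodule L act (range f)"
    unfolding submodule_def
  proof (intro conjI ballI subspace_range f(1))
    fix X w assume X: "X \<in> L" and "w \<in> range f"
    then obtain v where w: "w = f v" by blast
    from comm[OF X] obtain c where c: "\<forall>v. act X (f v) = f (act X v) + c *\<^sub>C f v" by (elim exE)
    have "act X w = f (act X v + c *\<^sub>C v)"
      by (simp add: w c clinear_add[OF f(1)] clinear_scale[OF f(1)])
    then show "act X w \<in> range f" by simp
  qed
  from min[OF this] have "range f = UNIV"
  proof
    assume "range f = {0}"
    then have "f = (\<lambda>v. 0)" by (auto simp: fun_eq_iff)
    with f(2) show ?thesis by (rule notE)
  qed
  with \<open>inj f\<close> show ?thesis by (simp add: bij_def)
qed

text \<open>The degree in \<open>\<int>\<^sup>n\<close> of an operator of degree \<open>m\<close> in \<open>t\<^sub>1, \<dots>, t\<^sub>n\<^sub>-\<^sub>1\<close> and degree \<open>0\<close> in \<open>t\<^sub>n\<close>.\<close>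

definition extend_degree :: "int ^ 'm \<Rightarrow> int ^ ('m::finite option)" where
  "extend_degree m = (\<chi> i. case i of None \<Rightarrow> 0 | Some j \<Rightarrow> m $ j)"

lemma extend_degree_axis: "extend_degree m = axis (Some i) c \<Longrightarrow> m = axis i c"
proof (subst vec_eq_iff, rule allI)
  fix j assume "extend_degree m = axis (Some i) c"
  then have "extend_degree m $ Some j = axis (Some i) c $ Some j" by simp
  then show "m $ j = axis i c $ j" by (simp add: extend_degree_def axis_def)
qed

lemma has_degree_K:
  fixes act :: "('g::complex_vector, 'm::finite) JD \<Rightarrow> 'v::complex_vector \<Rightarrow> 'v"
  assumes "lie_module (JD_bracket br form) (JD_sub UNIV) act" "cbilinear form"
  shows "has_degree act (act (JD_elem aff_K m)) (extend_degree m)"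
  unfolding has_degree_def
proof (intro allI)
  fix i :: "'m option" and v
  have X: "X \<in> JD_sub UNIV" for X :: "('g, 'm) JD" by (simp add: JD_sub_def)
  have bracket: "JD_bracket br form (JD_d i) (JD_elem aff_K m) =
      of_int (extend_degree m $ i) *\<^sub>C (JD_elem aff_K m :: ('g, 'm) JD)"
    by (cases i) (simp_all add: JD_bracket_d_elem extend_degree_def)
  have "act (JD_bracket br form (JD_d i) (JD_elem aff_K m)) v =
      act (JD_d i) (act (JD_elem aff_K m) v) - act (JD_elem aff_K m) (act (JD_d i) v)"
    using assms(1) X unfolding lie_module_def by blast
  moreover have "act (c *\<^sub>C JD_elem aff_K m) v = c *\<^sub>C act (JD_elem aff_K m) v" for c
    using assms(1) X unfolding lie_module_def by blast
  ultimately show "act (JD_d i) (act (JD_elem aff_K m) v) - act (JD_elem aff_K m) (act (JD_d i) v) =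
      of_int (extend_degree m $ i) *\<^sub>C act (JD_elem aff_K m) v"
    by (simp only: bracket)
qed

section \<open>Degrees of compositions, inverses and multiples\<close>

lemma has_degree_compose:
  assumes "has_degree act y m" "has_degree act z n" "clinear y"
  shows "has_degree act (y \<circ> z) (m + n)"
  unfolding has_degree_def
proof (intro allI)
  fix i v
  have "act (JD_d i) (y (z v)) = y (act (JD_d i) (z v)) + of_int (m $ i) *\<^sub>C y (z v)"
    using assms(1) by (simp add: has_degree_def algebra_simps)
  also have "act (JD_d i) (z v) = z (act (JD_d i) v) + of_int (n $ i) *\<^sub>C z v"
    using assms(2) by (simp add: has_degree_def algebra_simps)
  finally show "act (JD_d i) ((y \<circ> z) v) - (y \<circ> z) (act (JD_d i) v) = of_int ((m + n) $ i) *\<^sub>C (y \<circ> z) v"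
    by (simp add: clinear_add[OF assms(3)] clinear_scale[OF assms(3)] scaleC_add_left)
qed

lemma clinear_inverse:
  fixes f :: "'a::complex_vector \<Rightarrow> 'b::complex_vector"
  assumes "clinear f" "f \<circ> u = id" "u \<circ> f = id"
  shows "clinear u"
proof (rule clinearI)
  have fu: "f (u x) = x" for x using assms(2) by (simp add: fun_eq_iff)
  have uf: "u (f x) = x" for x using assms(3) by (simp add: fun_eq_iff)
  show "u (x + y) = u x + u y" for x y
    using uf[of "u x + u y"] by (simp add: clinear_add[OF assms(1)] fu)
  show "u (c *\<^sub>C x) = c *\<^sub>C u x" for c x
    using uf[of "c *\<^sub>C u x"] by (simp add: clinear_scale[OF assms(1)] fu)
qed

lemma has_degree_inverse:
  assumes f: "has_degree act f m" "clinear f" and inv: "f \<circ> u = id" "u \<circ> f = id"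
  shows "has_degree act u (- m)"
  unfolding has_degree_def
proof (intro allI)
  fix i v
  have fu: "f (u x) = x" and uf: "u (f x) = x" for x
    using inv by (simp_all add: fun_eq_iff)
  note u = clinear_inverse[OF f(2) inv]
  have "act (JD_d i) v - f (act (JD_d i) (u v)) = of_int (m $ i) *\<^sub>C v"
    using f(1) fu[of v] by (simp add: has_degree_def) (metis fu)
  then have "u (act (JD_d i) v - f (act (JD_d i) (u v))) = of_int (m $ i) *\<^sub>C u v"
    by (simp add: clinear_scale[OF u])
  then have "u (act (JD_d i) v) - act (JD_d i) (u v) = of_int (m $ i) *\<^sub>C u v"
    by (simp add: clinear_diff[OF u] uf)
  then show "act (JD_d i) (u v) - u (act (JD_d i) v) = of_int ((- m) $ i) *\<^sub>C u v"
    by (simp add: algebra_simps)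
qed

text \<open>It identifies the degree computed from the factors with the prescribed one; the zero
  operator would have every degree.\<close>

lemma has_degree_unique:
  assumes "has_degree act z m" "has_degree act z n" "z \<noteq> (\<lambda>v. 0)"
  shows "m = n"
proof -
  obtain v where v: "z v \<noteq> 0" using assms(3) by blast
  have "of_int (m $ i) *\<^sub>C z v = of_int (n $ i) *\<^sub>C z v" for i
    using assms(1,2) unfolding has_degree_def by metis
  then show ?thesis using v by (simp add: vec_eq_iff)
qed

lemma has_degree_scale:
  assumes "has_degree act z m" "\<And>i. clinear (act (JD_d i))"
  shows "has_degree act (\<lambda>v. c *\<^sub>C z v) m"
  unfolding has_degree_def
proof (intro allI)
  fix i v
  have "act (JD_d i) (c *\<^sub>C z v) - c *\<^sub>C z (act (JD_d i) v) =
      c *\<^sub>C (act (JD_d i) (z v) - z (act (JD_d i) v))"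
    by (simp add: clinear_scale[OF assms(2)] complex_vector.scale_right_diff_distrib)
  also have "act (JD_d i) (z v) - z (act (JD_d i) v) = of_int (m $ i) *\<^sub>C z v"
    using assms(1) by (simp add: has_degree_def)
  finally show "act (JD_d i) (c *\<^sub>C z v) - c *\<^sub>C z (act (JD_d i) v) = of_int (m $ i) *\<^sub>C c *\<^sub>C z v"
    by (simp add: scaleC_scaleC mult.commute)
qed

text \<open>An inverse factor negates the degree, so the induction has to carry \<open>m\<close> and
  \<open>- m\<close> together. The set \<open>\<Gamma>\<close> stands for
  \<open>shifts \<alpha>\<close>.\<close>

lemma central_product_degree:
  fixes act :: "('g::complex_vector, 'm::finite) JD \<Rightarrow> 'v::complex_vector \<Rightarrow> 'v"
  assumes mod: "lie_module (JD_bracket br form) (JD_sub UNIV) act" "cbilinear form"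
    and \<Gamma>: "0 \<in> \<Gamma>" "\<And>a b. a \<in> \<Gamma> \<Longrightarrow> b \<in> \<Gamma> \<Longrightarrow> a + b \<in> \<Gamma>"
    and K: "\<And>m. act (JD_elem aff_K m) \<noteq> (\<lambda>v. 0) \<Longrightarrow> m \<in> \<Gamma> \<and> - m \<in> \<Gamma>"
    and "central_product act y"
  shows "\<exists>m. m \<in> \<Gamma> \<and> - m \<in> \<Gamma> \<and> has_degree act y (extend_degree m)"
  using assms(6)
proof induction
  case one
  have "has_degree act id (extend_degree 0)"
    by (simp add: has_degree_def extend_degree_def split: option.split)
  then show ?case using \<Gamma>(1) by (intro exI[of _ 0]) (simp del: id_apply)
next
  have add: "extend_degree a + extend_degree b = extend_degree (a + b)" for a b :: "int ^ 'm"
    by (simp add: extend_degree_def vec_eq_iff split: option.split)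
  have minus: "- extend_degree a = extend_degree (- a)" for a :: "int ^ 'm"
    by (simp add: extend_degree_def vec_eq_iff split: option.split)
  have lin: "clinear (act X)" for X
  proof -
    have "X \<in> JD_sub UNIV" by (simp add: JD_sub_def)
    then show ?thesis using mod(1) by (simp add: lie_module_def)
  qed
  {
    case (factor z m)
    then obtain n where n: "n \<in> \<Gamma>" "- n \<in> \<Gamma>" "has_degree act z (extend_degree n)" by blast
    have "has_degree act (act (JD_elem aff_K m) \<circ> z) (extend_degree (m + n))"
      unfolding add[symmetric] by (intro has_degree_compose has_degree_K[OF mod] n(3) lin)
    moreover have "m + n \<in> \<Gamma>" "- (m + n) \<in> \<Gamma>"
      using \<Gamma>(2)[OF _ n(1), of m] \<Gamma>(2)[OF _ n(2), of "- m"] K[OF factor(2)]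
      by (simp_all add: algebra_simps)
    ultimately show ?case by blast
  next
    case (inverse z m u)
    then obtain n where n: "n \<in> \<Gamma>" "- n \<in> \<Gamma>" "has_degree act z (extend_degree n)" by blast
    have "has_degree act (u \<circ> z) (extend_degree (- m + n))"
      unfolding add[symmetric] minus[symmetric]
      by (intro has_degree_compose n(3) has_degree_inverse[OF has_degree_K[OF mod] lin inverse(3,4)]
          clinear_inverse[OF lin inverse(3,4)])
    moreover have "- m + n \<in> \<Gamma>" "- (- m + n) \<in> \<Gamma>"
      using \<Gamma>(2)[OF _ n(1), of "- m"] \<Gamma>(2)[OF _ n(2), of m] K[OF inverse(2)]
      by (simp_all add: algebra_simps)
    ultimately show ?case by blast
  }
qed

theorem mainTheorem11:
  fixes br :: "'g::complex_vector \<Rightarrow> 'g \<Rightarrow> 'g"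
    and form :: "'g \<Rightarrow> 'g \<Rightarrow> complex"
    and H :: "'g set"
    and act :: "('g, 'm::finite) JD \<Rightarrow> 'v::complex_vector \<Rightarrow> 'v"
    and z :: "'m \<Rightarrow> 'v \<Rightarrow> 'v"
    and k :: "'m \<Rightarrow> int"
    and W :: "'v set"
    and act1 :: "('g, 'm) JD \<Rightarrow> 'w::complex_vector \<Rightarrow> 'w"
    and q :: "'v \<Rightarrow> 'w"
    and \<alpha> :: "complex ^ 'm"
  assumes "simple_lie_algebra br"
    and "finite_dim (UNIV :: 'g set)"
    and "invariant_form br form"
    and "cartan_subalgebra br H"
    and "irreducible_module (JD_bracket br form) (JD_sub UNIV) act"
    and "weight_module (h_sub H UNIV) act"
    and "finite_dim_weight_spaces (h_sub H UNIV) act"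
    and "\<And>i. central_operator act (z i)"
    and "\<And>i. z i \<noteq> (\<lambda>v. 0)"
    and "\<And>i. k i > 0"
    and "\<And>i. has_degree act (z i) (axis (Some i) (k i))"
    and "maximal_submodule (JD_sub {None}) act W"
    and "quotient_module (JD_sub {None}) act W act1 q"
    and "irreducible_module (JD_bracket br form) (JD_sub {None}) act1"
    and "weight_module (h_sub H {None}) act1"
    and "finite_dim_weight_spaces (h_sub H {None}) act1"
  shows "completely_reducible (JD_sub UNIV) (pi_act \<alpha> act1)"
proof -
  have br: "cbilinear br" using assms(1) by (simp add: simple_lie_algebra_def lie_algebra_def)
  have form: "cbilinear form" using assms(3) by (simp add: invariant_form_def)
  obtain x y where "br x y \<noteq> 0" using assms(1) by (auto simp: simple_lie_algebra_def)
  \<comment> \<open>A zero form would by non-degeneracy make every vector zero, contrary to the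
    non-zero bracket.\<close>
  then have "\<exists>x y. form x y \<noteq> 0" using assms(3) unfolding invariant_form_def by metis
  then interpret irreducible_weight_module br form H act1
    using br form assms(2,14-16) by unfold_locales
  have V: "lie_module (JD_bracket br form) (JD_sub UNIV) act"
    "irreducible_submodule (JD_sub UNIV) act UNIV"
    using assms(5) by (simp_all add: irreducible_module_def)
  have X: "X \<in> JD_sub UNIV" for X :: "('g, 'm) JD" by (simp add: JD_sub_def)
  have lin: "clinear (act X)" for X
    using V(1) X unfolding lie_module_def by blast
  have bij: "bij (act (JD_elem aff_K m))" if nonzero: "act (JD_elem aff_K m) \<noteq> (\<lambda>v. 0)" for m
  proof (rule irreducible_bijective[OF V(2) lin lin nonzero])
    fix X :: "('g, 'm) JD"
    let ?c = "\<Sum>i\<in>UNIV. snd X $ Some i * of_int (m $ i)"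
    have "act X (act (JD_elem aff_K m) v) = act (JD_elem aff_K m) (act X v) +
        ?c *\<^sub>C act (JD_elem aff_K m) v" for v
    proof -
      have "act (JD_bracket br form X (JD_elem aff_K m)) v =
          act X (act (JD_elem aff_K m) v) - act (JD_elem aff_K m) (act X v)"
        using V(1) X unfolding lie_module_def by blast
      moreover have "act (?c *\<^sub>C JD_elem aff_K m) v = ?c *\<^sub>C act (JD_elem aff_K m) v"
        using V(1) X unfolding lie_module_def by blast
      ultimately show ?thesis by (simp add: JD_bracket_K[OF form] algebra_simps)
    qed
    then show "\<exists>c. \<forall>v. act X (act (JD_elem aff_K m) v) =
        act (JD_elem aff_K m) (act X v) + c *\<^sub>C act (JD_elem aff_K m) v" by blast
  qed
  have charge: "charge m \<noteq> 0" if nonzero: "act (JD_elem aff_K m) \<noteq> (\<lambda>v. 0)" for m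
  proof
    assume 0: "charge m = 0"
    have q: "q (act (JD_elem aff_K m) v) = act1 (JD_elem aff_K m) (q v)" "{v. q v = 0} = W" for v
      using assms(13) JD_elem_in_JD_sub unfolding quotient_module_def by blast+
    \<comment> \<open>K_n(m) is onto V, and charge 0 would put its image into the kernel of
      \<open>q\<close>.\<close>
    have "q v = 0" for v
    proof -
      obtain u where "v = act (JD_elem aff_K m) u" using bij[OF nonzero] by (metis bij_pointE)
      then show ?thesis by (simp add: q(1) act_K 0)
    qed
    then have "W = UNIV" using q(2) by blast
    then show False using assms(12) by (simp add: maximal_submodule_def)
  qed
  have "axis i (k i) \<in> shifts \<alpha> \<and> - axis i (k i) \<in> shifts \<alpha>" for i
  proof -
    obtain c y where y: "central_product act y" "z i = (\<lambda>v. c *\<^sub>C y v)"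
      using assms(8)[of i] unfolding central_operator_def by blast
    obtain m where m: "m \<in> shifts \<alpha>" "- m \<in> shifts \<alpha>" "has_degree act y (extend_degree m)"
      using central_product_degree[OF V(1) form shifts_zero shifts_add _ y(1)]
        charge charge_shift charge_shift_uminus by metis
    \<comment> \<open>The product \<open>y\<close> passes its degree to its non-zero multiple
      \<open>z i\<close>, whose degree is unique; hence the degree of \<open>y\<close> is the
      prescribed one.\<close>
    have "has_degree act (z i) (extend_degree m)"
      unfolding y(2) by (rule has_degree_scale[OF m(3) lin])
    then have "extend_degree m = axis (Some i) (k i)"
      by (rule has_degree_unique[OF _ assms(11,9)])
    then show ?thesis using m(1,2) extend_degree_axis by blast
  qed
  then show ?thesis by (intro pi_completely_reducible[where k = k] assms(10)) simp_all
qed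

end
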